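(* Let $A$ be a real $m\times 3$ matrix with rows $a_1,\dots,a_m$ and $B$ a real $3\times n$ matrix with columns $b_1,\dots,b_n$, all regarded as vectors in $\mathbb R^3$. Then the matrix $AB$ has nonnegative rank at most $3$ if and only if $AB\ge 0$ entrywise and the following condition holds: either $\operatorname{rank}(AB)<3$, or $\operatorname{rank}(AB)=3$ and at least one of (I), (II) holds. (I) There exist indices $i,j\in[m]$ and $i',j'\in[n]$ such that: (i) the sign of $\det(a_i,a_j,a_k)$ is the same or zero for all $k\in[m]\setminus\{i,j\}$; (ii) the sign of $\det(a_i\times a_j,\,b_{i'},\,b_{k'})$ is the same or zero for all $k'\in[n]\setminus\{i'\}$; (iii) the sign of $\det(a_i\times a_j,\,b_{j'},\,b_{k'})$ is the same or zero for all $k'\in[n]\setminus\{j'\}$; (iv) for all $\{k,l\}\subseteq[m]\setminus\{i,j\}$ and all $k'\in[n]\setminus\{i',j'\}$, $$F_{k,l,k'}\cdot F_{l,k,k'}\ \ge\ 0,$$ where $$F_{k,l,k'}=\det\Big(\big((a_i\times a_j)\times b_{i'}\big)\times a_k,\ \big((a_i\times a_j)\times b_{j'}\big)\times a_l,\ b_{k'}\Big).$$ (II) There exist $i,j\in[n]$ and $i',j'\in[m]$ such that the conditions (i)–(iv) hold after swapping $A$ with $B^T$, i.e. with $m$ and $n$ interchanged, the rows $a_1,\dots,a_m$ replaced by the columns $b_1,\dots,b_n$ of $B$, and the columns $b_1,\dots,b_n$ replaced by the rows $a_1,\dots,a_m$ of $A$.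
   Context: $[m]=\{1,\dots,m\}$; $\times$ is the cross product in $\mathbb R^3$ and $\det(x,y,z)$ is the determinant of the $3\times3$ matrix with rows $x,y,z$. "The sign is the same or zero" for a family of numbers means that they are all $\ge0$ or all $\le0$. A real $m\times n$ matrix $P$ has nonnegative rank $\le 3$ if $P=A'B'$ for some entrywise nonnegative $m\times3$ matrix $A'$ and nonnegative $3\times n$ matrix $B'$. Geometrically, the $a_i$ represent lines and the $b_j$ represent points in the projective plane; $a_i\times a_j$ is the intersection point of two lines, and the cross product of two points is the line they span.
   Formalization: Condition (I) additionally requires a_i×a_j, (a_i×a_j)×b_{i'} and (a_i×a_j)×b_{j'} to be nonzero (and likewise in (II)); without this, i=j makes (i)–(iv) hold trivially and the claim fails, e.g. for the 4×4 slack matrix of a square. *)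

theory Defs
  imports "HOL-Analysis.Analysis"
begin

unbundle cross3_syntax

definition nonneg_matrix :: "real^'n^'m \<Rightarrow> bool" where
  "nonneg_matrix P \<longleftrightarrow> (\<forall>i j. 0 \<le> P $ i $ j)"

definition nonneg_rank_le_3 :: "real^'n^'m \<Rightarrow> bool" where
  "nonneg_rank_le_3 P \<longleftrightarrow>
    (\<exists>(A' :: real^3^'m) (B' :: real^'n^3).
      nonneg_matrix A' \<and> nonneg_matrix B' \<and> P = A' ** B')"

text \<open>The determinant of the matrix with rows \<open>x\<close>, \<open>y\<close>, \<open>z\<close>.\<close>

definition det3 :: "real^3 \<Rightarrow> real^3 \<Rightarrow> real^3 \<Rightarrow> real" where
  "det3 x y z = det (vector [x, y, z] :: real^3^3)"

definition same_sign_or_zero :: "('k \<Rightarrow> real) \<Rightarrow> 'k set \<Rightarrow> bool" where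
  "same_sign_or_zero f K \<longleftrightarrow> (\<forall>k\<in>K. 0 \<le> f k) \<or> (\<forall>k\<in>K. f k \<le> 0)"

text \<open>With \<open>v\<close> the point \<open>a\<^sub>i \<times> a\<^sub>j\<close> and \<open>b\<close>, \<open>b'\<close> the points \<open>b\<^bsub>i'\<^esub>\<close>, \<open>b\<^bsub>j'\<^esub>\<close>,
  \<open>F_det v b b' a\<^sub>k a\<^sub>l b\<^bsub>k'\<^esub>\<close> is the number \<open>F\<^bsub>k,l,k'\<^esub>\<close>.\<close>

definition F_det ::
    "real^3 \<Rightarrow> real^3 \<Rightarrow> real^3 \<Rightarrow> real^3 \<Rightarrow> real^3 \<Rightarrow> real^3 \<Rightarrow> real" where
  "F_det v b b' x y z = det3 ((v \<times> b) \<times> x) ((v \<times> b') \<times> y) z"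

text \<open>The three inequations with \<open>0\<close> say that the projective objects the determinants are
  about exist: the lines \<open>a\<^sub>i\<close> and \<open>a\<^sub>j\<close> are distinct, so that \<open>a\<^sub>i \<times> a\<^sub>j\<close> is their
  intersection point, and this point is different from the points \<open>b\<^bsub>i'\<^esub>\<close> and \<open>b\<^bsub>j'\<^esub>\<close>, so that
  it spans a line with each of them. Without them the remaining conditions could be satisfied by
  vanishing cross products only (always so with \<open>i = j\<close>). Neither \<open>i' \<noteq> j'\<close> nor \<open>k \<noteq> l\<close> is
  required; for \<open>k = l\<close> the last inequality is trivial.\<close>

definition condition_I :: "real^3^'m \<Rightarrow> real^'n^3 \<Rightarrow> bool" where
  "condition_I A B \<longleftrightarrow>
    (let a = (\<lambda>i. row i A); b = (\<lambda>j. column j B) in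
      \<exists>i j i' j'.
        a i \<times> a j \<noteq> 0 \<and> (a i \<times> a j) \<times> b i' \<noteq> 0 \<and> (a i \<times> a j) \<times> b j' \<noteq> 0 \<and>
        same_sign_or_zero (\<lambda>k. det3 (a i) (a j) (a k)) (UNIV - {i, j}) \<and>
        same_sign_or_zero (\<lambda>k'. det3 (a i \<times> a j) (b i') (b k')) (UNIV - {i'}) \<and>
        same_sign_or_zero (\<lambda>k'. det3 (a i \<times> a j) (b j') (b k')) (UNIV - {j'}) \<and>
        (\<forall>k l k'. {k, l} \<subseteq> UNIV - {i, j} \<longrightarrow> k' \<in> UNIV - {i', j'} \<longrightarrow>
          0 \<le> F_det (a i \<times> a j) (b i') (b j') (a k) (a l) (b k')
              * F_det (a i \<times> a j) (b i') (b j') (a l) (a k) (b k')))"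

definition condition_II :: "real^3^'m \<Rightarrow> real^'n^3 \<Rightarrow> bool" where
  "condition_II A B \<longleftrightarrow> condition_I (transpose B) (transpose A)"

end

theory Submission
  imports Defs
begin

text \<open>If \<open>A B\<close> has rank 3, a nonnegative factorization through dimension 3 is the same as a simplicial
  cone nested between the cone generated by the \<open>b\<^sub>j\<close> and the cone \<open>{x. \<forall>k. a\<^sub>k \<bullet> x \<ge> 0}\<close>;
  projectively, a triangle nested between two convex polygons. Condition (I) says that there is such
  a triangle with a vertex at a vertex \<open>a\<^sub>i \<times> a\<^sub>j\<close> of the outer polygon: its sides through that
  vertex may be taken tangent to the inner polygon, and (iv) compares the third side with the
  points where these tangents leave the outer polygon. Dually, (II) says that there is one with an
  edge containing an edge of the inner polygon.

  That one of the two can always be achieved is shown by contradiction. First all vertices are pushed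
  to the boundary of the outer polygon, and by compactness the triangle is rotated as far as possible
  in one direction, so that every edge touches the inner polygon. Let the vertex \<open>m\<^sub>i\<close> move on its
  line to \<open>m\<^sub>i + s\<^sub>i d\<^sub>i\<close> while the edges keep passing through the points of contact. In
  the parameters \<open>1 / s\<^sub>i\<close> each step from a vertex to the next is an affine map with nonnegative
  constant term, so in one of the two directions the first vertex does not overtake its image
  after a full turn. Sliding in that direction, the triangle stays nested until it meets a new
  vertex of the outer or a new point of the inner polygon, and this must happen since the
  parameter is bounded. Matrices of rank at most 2 are elementary: two extreme columns generate all
  the others.\<close>

section \<open>Nested cones and the vertex condition\<close>

lemma det3_eq_dot_cross: "det3 x y z = x \<bullet> (y \<times> z)"
  by (simp add: det3_def dot_cross_det)

lemma det3_rotate: "det3 x y z = det3 y z x" "det3 x y z = det3 z x y"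
  by (simp_all add: det3_eq_dot_cross cross3_simps)

lemma det3_swap: "det3 y x z = - det3 x y z" "det3 x z y = - det3 x y z"
  by (simp_all add: det3_eq_dot_cross cross3_simps)

lemma det3_repeated [simp]: "det3 x x y = 0" "det3 x y x = 0" "det3 x y y = 0"
  by (simp_all add: det3_eq_dot_cross dot_cross_self)

lemma det3_scaleR:
  "det3 (c *\<^sub>R x) y z = c * det3 x y z" "det3 x (c *\<^sub>R y) z = c * det3 x y z"
  "det3 x y (c *\<^sub>R z) = c * det3 x y z"
  by (simp_all add: det3_eq_dot_cross cross_mult_left cross_mult_right)

lemma det3_add:
  "det3 (x + x') y z = det3 x y z + det3 x' y z" "det3 x (y + y') z = det3 x y z + det3 x y' z"
  "det3 x y (z + z') = det3 x y z + det3 x y z'"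
  by (simp_all add: det3_eq_dot_cross cross_add_left cross_add_right inner_add_left inner_add_right)

lemma det3_combination:
  "det3 (u1 *\<^sub>R m1 + u2 *\<^sub>R m2 + u3 *\<^sub>R m3) (v1 *\<^sub>R m1 + v2 *\<^sub>R m2 + v3 *\<^sub>R m3)
     (w1 *\<^sub>R m1 + w2 *\<^sub>R m2 + w3 *\<^sub>R m3) =
   (u1 * (v2 * w3 - v3 * w2) - u2 * (v1 * w3 - v3 * w1) + u3 * (v1 * w2 - v2 * w1)) * det3 m1 m2 m3"
proof -
  have e: "det3 m1 m3 m2 = - det3 m1 m2 m3" "det3 m2 m1 m3 = - det3 m1 m2 m3"
    "det3 m3 m2 m1 = - det3 m1 m2 m3" "det3 m2 m3 m1 = det3 m1 m2 m3" "det3 m3 m1 m2 = det3 m1 m2 m3"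
    by (simp_all add: det3_eq_dot_cross cross3_simps)
  show ?thesis
    by (simp add: det3_add det3_scaleR e) (simp add: algebra_simps)
qed

text \<open>Cramer's rule without division, valid for dependent \<open>x\<close>, \<open>y\<close>,
  \<open>z\<close> as well.\<close>

lemma det3_cramer:
  "det3 x y z *\<^sub>R w = det3 w y z *\<^sub>R x + det3 x w z *\<^sub>R y + det3 x y w *\<^sub>R z"
  by (simp add: det3_def det_3 vec_eq_iff forall_3 vector_def algebra_simps)

text \<open>Full rank of \<open>A\<close> and \<open>B\<close> enters in this form: some
  \<open>f i\<close> is not orthogonal to a given nonzero vector.\<close>

definition spans :: "('i \<Rightarrow> real^3) \<Rightarrow> bool" where
  "spans f \<longleftrightarrow> (\<forall>x. (\<forall>i. f i \<bullet> x = 0) \<longrightarrow> x = 0)"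

lemma spansD: "spans f \<Longrightarrow> x \<noteq> 0 \<Longrightarrow> \<exists>i. f i \<bullet> x \<noteq> 0"
  unfolding spans_def by blast

text \<open>The cone generated by \<open>m1\<close>, \<open>m2\<close>, \<open>m3\<close> lies between the cone generated by the \<open>b j\<close> and
  the cone cut out by the \<open>a k\<close>; projectively, a triangle nested between two polygons.\<close>

definition nested :: "('m \<Rightarrow> real^3) \<Rightarrow> ('n \<Rightarrow> real^3) \<Rightarrow> real^3 \<Rightarrow> real^3 \<Rightarrow> real^3 \<Rightarrow> bool" where
  "nested a b m1 m2 m3 \<longleftrightarrow>
    (\<forall>k. 0 \<le> a k \<bullet> m1 \<and> 0 \<le> a k \<bullet> m2 \<and> 0 \<le> a k \<bullet> m3) \<and>
    (\<forall>j. \<exists>x y z. 0 \<le> x \<and> 0 \<le> y \<and> 0 \<le> z \<and> b j = x *\<^sub>R m1 + y *\<^sub>R m2 + z *\<^sub>R m3)"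

lemma nested_rotate: "nested a b m1 m2 m3 \<Longrightarrow> nested a b m2 m3 m1"
  and nested_swap: "nested a b m1 m2 m3 \<Longrightarrow> nested a b m1 m3 m2"
proof -
  assume n: "nested a b m1 m2 m3"
  have "(\<exists>x y z. 0 \<le> x \<and> 0 \<le> y \<and> 0 \<le> z \<and> b j = x *\<^sub>R m2 + y *\<^sub>R m3 + z *\<^sub>R m1) \<and>
      (\<exists>x y z. 0 \<le> x \<and> 0 \<le> y \<and> 0 \<le> z \<and> b j = x *\<^sub>R m1 + y *\<^sub>R m3 + z *\<^sub>R m2)" for j
  proof -
    obtain x y z where "0 \<le> x" "0 \<le> y" "0 \<le> z" and b: "b j = x *\<^sub>R m1 + y *\<^sub>R m2 + z *\<^sub>R m3"
      using n unfolding nested_def by blast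
    moreover from b have "b j = y *\<^sub>R m2 + z *\<^sub>R m3 + x *\<^sub>R m1" "b j = x *\<^sub>R m1 + z *\<^sub>R m3 + y *\<^sub>R m2"
      by simp_all
    ultimately show ?thesis by blast
  qed
  then show "nested a b m2 m3 m1" "nested a b m1 m3 m2"
    using n unfolding nested_def by blast+
qed

lemma nested_imp_dual_nonneg: "nested a b m1 m2 m3 \<Longrightarrow> 0 \<le> a k \<bullet> b j"
proof -
  assume n: "nested a b m1 m2 m3"
  then obtain x y z where "0 \<le> x" "0 \<le> y" "0 \<le> z" "b j = x *\<^sub>R m1 + y *\<^sub>R m2 + z *\<^sub>R m3"
    unfolding nested_def by blast
  with n show ?thesis by (simp add: nested_def inner_add_right)
qed

lemma det3_eq_0_orthogonal:
  assumes "det3 x y z = 0"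
  obtains w where "w \<noteq> 0" "x \<bullet> w = 0" "y \<bullet> w = 0" "z \<bullet> w = 0"
proof -
  let ?M = "vector [x, y, z] :: real^3^3"
  have "\<not> invertible ?M" using assms by (simp add: det3_def invertible_det_nz)
  then obtain w where "w \<noteq> 0" "?M *v w = 0"
    by (metis invertible_left_inverse matrix_left_invertible_ker)
  moreover have "(?M *v w) $ 1 = x \<bullet> w" "(?M *v w) $ 2 = y \<bullet> w" "(?M *v w) $ 3 = z \<bullet> w"
    by (simp_all add: matrix_vector_mul_component)
  ultimately show thesis using that by force
qed

text \<open>A common normal \<open>w\<close> of the three generators would be orthogonal to every
  \<open>b j\<close>.\<close>

lemma nested_det3_nonzero:
  assumes "nested a b m1 m2 m3" "spans b"
  shows "det3 m1 m2 m3 \<noteq> 0"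
proof
  assume "det3 m1 m2 m3 = 0"
  then obtain w where w: "w \<noteq> 0" "m1 \<bullet> w = 0" "m2 \<bullet> w = 0" "m3 \<bullet> w = 0"
    by (rule det3_eq_0_orthogonal)
  have "b j \<bullet> w = 0" for j
  proof -
    obtain x y z where "b j = x *\<^sub>R m1 + y *\<^sub>R m2 + z *\<^sub>R m3"
      using assms(1) unfolding nested_def by blast
    then show ?thesis using w by (simp add: inner_add_left)
  qed
  then show False using assms(2) w(1) by (auto dest: spansD)
qed

text \<open>Condition (I) for families of vectors instead of matrices; exchanging the two arguments
  gives (II).\<close>

definition vertex_condition :: "('m \<Rightarrow> real^3) \<Rightarrow> ('n \<Rightarrow> real^3) \<Rightarrow> bool" where
  "vertex_condition a b \<longleftrightarrow>
    (\<exists>i j i' j'.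
      a i \<times> a j \<noteq> 0 \<and> (a i \<times> a j) \<times> b i' \<noteq> 0 \<and> (a i \<times> a j) \<times> b j' \<noteq> 0 \<and>
      same_sign_or_zero (\<lambda>k. det3 (a i) (a j) (a k)) (UNIV - {i, j}) \<and>
      same_sign_or_zero (\<lambda>k'. det3 (a i \<times> a j) (b i') (b k')) (UNIV - {i'}) \<and>
      same_sign_or_zero (\<lambda>k'. det3 (a i \<times> a j) (b j') (b k')) (UNIV - {j'}) \<and>
      (\<forall>k l k'. {k, l} \<subseteq> UNIV - {i, j} \<longrightarrow> k' \<in> UNIV - {i', j'} \<longrightarrow>
        0 \<le> F_det (a i \<times> a j) (b i') (b j') (a k) (a l) (b k')
            * F_det (a i \<times> a j) (b i') (b j') (a l) (a k) (b k')))"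

lemma condition_I_eq: "condition_I A B \<longleftrightarrow> vertex_condition (\<lambda>i. row i A) (\<lambda>j. column j B)"
  unfolding condition_I_def vertex_condition_def Let_def ..

lemma condition_II_eq: "condition_II A B \<longleftrightarrow> vertex_condition (\<lambda>j. column j B) (\<lambda>i. row i A)"
  unfolding condition_II_def condition_I_eq by simp

text \<open>The pairs \<open>(x j, y j)\<close> lie in the closed quadrant and \<open>i\<close> has
  the smallest slope. Minimizing \<open>y / (x + y)\<close> instead of \<open>y / x\<close> covers
  vertical directions. This finds the tangents from a vertex to the inner polygon.\<close>

lemma extremal_direction:
  fixes x y :: "'n::finite \<Rightarrow> real"
  assumes nn: "\<And>j. 0 \<le> x j" "\<And>j. 0 \<le> y j" and nz: "\<exists>j. x j \<noteq> 0 \<or> y j \<noteq> 0"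
  obtains i where "x i \<noteq> 0 \<or> y i \<noteq> 0" "\<And>j. x j * y i \<le> x i * y j"
proof -
  let ?S = "{j. x j \<noteq> 0 \<or> y j \<noteq> 0}"
  have "finite ?S" "?S \<noteq> {}" using nz by auto
  then obtain i where i: "i \<in> ?S" "\<And>j. j \<in> ?S \<Longrightarrow> y i / (x i + y i) \<le> y j / (x j + y j)"
    using ex_is_arg_min_if_finite[of ?S "\<lambda>j. y j / (x j + y j)"]
    unfolding is_arg_min_linorder by blast
  have pos: "0 < x j + y j" if "j \<in> ?S" for j using that nn[of j] by auto
  have "x j * y i \<le> x i * y j" for j
  proof (cases "j \<in> ?S")
    case True
    with i pos have "y i / (x i + y i) \<le> y j / (x j + y j)" by blast
    with pos[OF i(1)] pos[OF True] have "y i * (x j + y j) \<le> y j * (x i + y i)"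
      by (simp add: divide_le_eq pos_le_divide_eq field_simps)
    then show ?thesis by (simp add: algebra_simps)
  qed auto
  with i(1) that show thesis by blast
qed

text \<open>Both points in \<open>F_det\<close> are expanded by the Lagrange identity. The terms are
  grouped so that each is nonnegative for a nested triangle with tangent lines.\<close>

lemma F_det_coordinates:
  assumes "b = s *\<^sub>R m1 + e *\<^sub>R m2 + f *\<^sub>R m3" "b' = s' *\<^sub>R m1 + e' *\<^sub>R m2 + f' *\<^sub>R m3"
    "z = z1 *\<^sub>R m1 + z2 *\<^sub>R m2 + z3 *\<^sub>R m3"
  shows "F_det (c *\<^sub>R m1) b b' x y z = c\<^sup>2 * det3 m1 m2 m3 *
    ((e * (m2 \<bullet> x) + f * (m3 \<bullet> x)) * (m1 \<bullet> y) * (f' * z2 - e' * z3)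
     + (m1 \<bullet> x) * (e' * (m2 \<bullet> y) + f' * (m3 \<bullet> y)) * (e * z3 - f * z2)
     + (m1 \<bullet> x) * (m1 \<bullet> y) * z1 * (e * f' - f * e'))"
proof -
  have L: "(v \<times> w) \<times> u = (v \<bullet> u) *\<^sub>R w - (w \<bullet> u) *\<^sub>R v" for u v w :: "real^3"
    by (metis (no_types, lifting) Lagrange cross_skew inner_commute minus_diff_eq)
  have p: "((c *\<^sub>R m1) \<times> b) \<times> x = (- c * (e * (m2 \<bullet> x) + f * (m3 \<bullet> x))) *\<^sub>R m1
       + (c * (m1 \<bullet> x) * e) *\<^sub>R m2 + (c * (m1 \<bullet> x) * f) *\<^sub>R m3"
    unfolding L assms by (simp add: inner_add_left algebra_simps)
  have q: "((c *\<^sub>R m1) \<times> b') \<times> y = (- c * (e' * (m2 \<bullet> y) + f' * (m3 \<bullet> y))) *\<^sub>R m1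
       + (c * (m1 \<bullet> y) * e') *\<^sub>R m2 + (c * (m1 \<bullet> y) * f') *\<^sub>R m3"
    unfolding L assms by (simp add: inner_add_left algebra_simps)
  show ?thesis
    unfolding F_det_def p q assms(3) det3_combination
    by (simp add: algebra_simps power2_eq_square)
qed

lemma orthogonal_parallel_cross:
  assumes "x \<bullet> m = 0" "y \<bullet> m = 0" "x \<times> y \<noteq> 0" 
  obtains c where "m = c *\<^sub>R (x \<times> y)"
proof -
  have "(x \<times> y) \<times> m = 0"
    using assms by (metis Lagrange cross_skew diff_self inner_commute minus_zero scaleR_zero_left)
  then have "collinear {0, x \<times> y, m}" by (simp add: cross_eq_0)
  with assms(3) that show thesis by (auto simp: collinear_lemma)
qed

text \<open>From \<open>m1\<close> the inner polygon is seen between two tangents. With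
  \<open>i'\<close> and \<open>j'\<close> on them, every \<open>F_det\<close> is a nonnegative
  multiple of the same number, so all products are nonnegative.\<close>

lemma vertex_imp_vertex_condition:
  fixes a :: "'m \<Rightarrow> real^3" and b :: "'n::finite \<Rightarrow> real^3"
  assumes n: "nested a b m1 m2 m3" and sb: "spans b"
    and i: "a i \<bullet> m1 = 0" "a j \<bullet> m1 = 0" "a i \<times> a j \<noteq> 0"
  shows "vertex_condition a b"
proof -
  have D: "det3 m1 m2 m3 \<noteq> 0" using nested_det3_nonzero[OF n sb] .
  then have "m1 \<noteq> 0" by (auto simp: det3_eq_dot_cross)
  obtain c' where c': "m1 = c' *\<^sub>R (a i \<times> a j)" using orthogonal_parallel_cross[OF i] .
  define c where "c = 1 / c'"
  have v: "a i \<times> a j = c *\<^sub>R m1" and "c \<noteq> 0"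
    using c' \<open>m1 \<noteq> 0\<close> by (auto simp: c_def)
  have "\<forall>j. \<exists>x y z. 0 \<le> x \<and> 0 \<le> y \<and> 0 \<le> z \<and> b j = x *\<^sub>R m1 + y *\<^sub>R m2 + z *\<^sub>R m3"
    using n by (simp add: nested_def)
  then obtain x y z where xyz: "\<And>j. 0 \<le> x j" "\<And>j. 0 \<le> y j" "\<And>j. 0 \<le> z j"
    and b: "\<And>j. b j = x j *\<^sub>R m1 + y j *\<^sub>R m2 + z j *\<^sub>R m3" by metis
  have nz: "\<exists>j. y j \<noteq> 0 \<or> z j \<noteq> 0"
  proof -
    have "m1 \<times> m2 \<noteq> 0" using D by (metis det3_eq_dot_cross det3_rotate(1) inner_zero_right)
    then obtain j where "b j \<bullet> (m1 \<times> m2) \<noteq> 0" using sb by (auto dest: spansD)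
    then have "z j \<noteq> 0" by (auto simp: b inner_add_left dot_cross_self)
    then show ?thesis by blast
  qed
  \<comment> \<open>The pair \<open>(y k, z k)\<close> is the direction in which \<open>b k\<close>
    is seen from \<open>m1\<close>; \<open>i'\<close> and \<open>j'\<close> are the two
    extremes.\<close>
  obtain i' where i': "y i' \<noteq> 0 \<or> z i' \<noteq> 0" "\<And>k. y k * z i' \<le> y i' * z k"
    using extremal_direction[OF xyz(2,3) nz] by blast
  have nz': "\<exists>j. z j \<noteq> 0 \<or> y j \<noteq> 0" using nz by blast
  obtain j' where j': "z j' \<noteq> 0 \<or> y j' \<noteq> 0" "\<And>k. z k * y j' \<le> z j' * y k"
    using extremal_direction[OF xyz(3,2) nz'] by blast
  have det: "det3 (a i \<times> a j) (b k) (b l) = c * det3 m1 m2 m3 * (y k * z l - z k * y l)" for k l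
    using det3_combination[of 1 m1 0 m2 0 m3 "x k" "y k" "z k" "x l" "y l" "z l"]
    by (simp add: v b det3_scaleR)
  have cr: "(a i \<times> a j) \<times> b k \<noteq> 0" if k: "y k \<noteq> 0 \<or> z k \<noteq> 0" for k
  proof
    assume 0: "(a i \<times> a j) \<times> b k = 0"
    have "det3 (a i \<times> a j) (b k) m2 = - c * det3 m1 m2 m3 * z k"
      "det3 (a i \<times> a j) (b k) m3 = c * det3 m1 m2 m3 * y k"
      using det3_combination[of 1 m1 0 m2 0 m3 "x k" "y k" "z k" 0 1 0]
        det3_combination[of 1 m1 0 m2 0 m3 "x k" "y k" "z k" 0 0 1]
      by (simp_all add: v b det3_scaleR)
    moreover have "det3 (a i \<times> a j) (b k) w = 0" for w
      by (metis "0" det3_eq_dot_cross det3_rotate(1) inner_zero_right)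
    ultimately show False using k D \<open>c \<noteq> 0\<close> by auto
  qed
  have am: "0 \<le> a k \<bullet> m1" "0 \<le> a k \<bullet> m2" "0 \<le> a k \<bullet> m3" for k
    using n by (simp_all add: nested_def)
  have s1: "same_sign_or_zero (\<lambda>k. det3 (a i) (a j) (a k)) (UNIV - {i, j})"
  proof -
    have "det3 (a i) (a j) (a k) = c * (a k \<bullet> m1)" for k
      using v by (metis det3_eq_dot_cross det3_rotate(1) inner_commute inner_scaleR_left det3_rotate(2))
    then show ?thesis using am unfolding same_sign_or_zero_def
      by (metis linear mult_nonneg_nonneg mult_nonpos_nonneg)
  qed
  have s2: "same_sign_or_zero (\<lambda>k'. det3 (a i \<times> a j) (b i') (b k')) (UNIV - {i'})"
    unfolding same_sign_or_zero_def det using i'(2)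
    by (metis (no_types, opaque_lifting) diff_ge_0_iff_ge linear mult.commute mult_nonneg_nonneg mult_nonpos_nonneg)
  have s3: "same_sign_or_zero (\<lambda>k'. det3 (a i \<times> a j) (b j') (b k')) (UNIV - {j'})"
    unfolding same_sign_or_zero_def det using j'(2)
    by (metis (no_types, opaque_lifting) diff_le_0_iff_le linear mult.commute mult_nonneg_nonpos mult_nonpos_nonpos)
  \<comment> \<open>The factor in front of \<open>G\<close> does not depend on \<open>k\<close>,
    \<open>l\<close>, \<open>k'\<close>, so it enters a product of two such numbers as a
    square.\<close>
  have F: "\<exists>G\<ge>0. F_det (a i \<times> a j) (b i') (b j') (a k) (a l) (b k') = c\<^sup>2 * det3 m1 m2 m3 * G" for k l k'
  proof -
    have 1: "0 \<le> z j' * y k' - y j' * z k'" "0 \<le> y i' * z k' - z i' * y k'" "0 \<le> y i' * z j' - z i' * y j'"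
      using j'(2)[of k'] i'(2)[of k'] i'(2)[of j'] by (simp_all add: mult.commute)
    show ?thesis unfolding v F_det_coordinates[OF b b b]
      by (rule exI, rule conjI[OF _ refl], intro add_nonneg_nonneg mult_nonneg_nonneg)
        (use 1 xyz am in \<open>simp_all add: inner_commute\<close>)
  qed
  have FF: "0 \<le> F_det (a i \<times> a j) (b i') (b j') (a k) (a l) (b k')
            * F_det (a i \<times> a j) (b i') (b j') (a l) (a k) (b k')" for k l k'
  proof -
    obtain G H where "0 \<le> G" "0 \<le> H" and
      e: "F_det (a i \<times> a j) (b i') (b j') (a k) (a l) (b k') = c\<^sup>2 * det3 m1 m2 m3 * G"
      "F_det (a i \<times> a j) (b i') (b j') (a l) (a k) (b k') = c\<^sup>2 * det3 m1 m2 m3 * H"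
      using F by metis
    have "(c\<^sup>2 * det3 m1 m2 m3 * G) * (c\<^sup>2 * det3 m1 m2 m3 * H) = (c\<^sup>2 * det3 m1 m2 m3)\<^sup>2 * (G * H)"
      by (simp add: power2_eq_square)
    then show ?thesis using \<open>0 \<le> G\<close> \<open>0 \<le> H\<close> e by (metis mult_nonneg_nonneg zero_le_power2)
  qed
  show ?thesis unfolding vertex_condition_def
    using i(3) cr i'(1) j'(1) s1 s2 s3 FF by blast
qed

text \<open>The scaled cross products form the basis dual to \<open>m1\<close>, \<open>m2\<close>,
  \<open>m3\<close>, so generating and bounding vectors exchange roles and edges become
  vertices.\<close>

lemma nested_dual:
  fixes a :: "'m \<Rightarrow> real^3" and b :: "'n \<Rightarrow> real^3"
  assumes n: "nested a b m1 m2 m3" and D: "det3 m1 m2 m3 \<noteq> 0"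
  defines "e \<equiv> 1 / det3 m1 m2 m3"
  shows "nested b a (e *\<^sub>R (m1 \<times> m2)) (e *\<^sub>R (m2 \<times> m3)) (e *\<^sub>R (m3 \<times> m1))"
proof -
  let ?d = "det3 m1 m2 m3"
  have d: "m1 \<bullet> (m2 \<times> m3) = ?d" "m2 \<bullet> (m3 \<times> m1) = ?d" "m3 \<bullet> (m1 \<times> m2) = ?d"
    by (simp_all add: det3_eq_dot_cross cross3_simps)
  have ex: "?d *\<^sub>R w = (w \<bullet> m3) *\<^sub>R (m1 \<times> m2) + (w \<bullet> m1) *\<^sub>R (m2 \<times> m3) + (w \<bullet> m2) *\<^sub>R (m3 \<times> m1)" for w
    by (simp add: det3_eq_dot_cross cross3_simps forall_3)
  have "a k = (a k \<bullet> m3) *\<^sub>R (e *\<^sub>R (m1 \<times> m2)) + (a k \<bullet> m1) *\<^sub>R (e *\<^sub>R (m2 \<times> m3)) + (a k \<bullet> m2) *\<^sub>R (e *\<^sub>R (m3 \<times> m1))" for k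
  proof -
    have "a k = e *\<^sub>R (?d *\<^sub>R a k)" using D by (simp add: e_def)
    then show ?thesis unfolding ex by (simp add: scaleR_right_distrib mult.commute)
  qed
  moreover have "0 \<le> b j \<bullet> (e *\<^sub>R (m1 \<times> m2)) \<and> 0 \<le> b j \<bullet> (e *\<^sub>R (m2 \<times> m3)) \<and> 0 \<le> b j \<bullet> (e *\<^sub>R (m3 \<times> m1))" for j
  proof -
    obtain x y z where "0 \<le> x" "0 \<le> y" "0 \<le> z" "b j = x *\<^sub>R m1 + y *\<^sub>R m2 + z *\<^sub>R m3"
      using n unfolding nested_def by blast
    then show ?thesis using D by (simp add: inner_add_left d dot_cross_self e_def)
  qed
  ultimately show ?thesis using n unfolding nested_def by metis
qed

text \<open>In the dual triangle the edge from \<open>m1\<close> to \<open>m2\<close> becomes the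
  first vertex, and the points \<open>b i\<close>, \<open>b j\<close> on it become lines through
  that vertex.\<close>

lemma edge_imp_vertex_condition:
  fixes a :: "'m::finite \<Rightarrow> real^3" and b :: "'n \<Rightarrow> real^3"
  assumes n: "nested a b m1 m2 m3" and s: "spans a" "spans b"
    and i: "b i = x *\<^sub>R m1 + y *\<^sub>R m2" "b j = x' *\<^sub>R m1 + y' *\<^sub>R m2" "b i \<times> b j \<noteq> 0"
  shows "vertex_condition b a"
  by (rule vertex_imp_vertex_condition[OF nested_dual[OF n nested_det3_nonzero[OF n s(2)]] s(1) _ _ i(3)])
    (simp_all add: i(1,2) inner_add_left dot_cross_self)

section \<open>Sliding the vertices of a nested cone\<close>

lemma max_step:
  fixes c e :: "'i \<Rightarrow> real"
  assumes "finite I" "\<And>i. i \<in> I \<Longrightarrow> 0 \<le> c i" "i0 \<in> I" "e i0 < 0"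
  obtains t i where "0 \<le> t" "\<And>i. i \<in> I \<Longrightarrow> 0 \<le> c i + t * e i" "i \<in> I" "e i < 0" "c i + t * e i = 0"
proof -
  let ?S = "{i \<in> I. e i < 0}"
  have "finite ?S" "?S \<noteq> {}" using assms by auto
  \<comment> \<open>The ratio test of the simplex method: the constraint with the smallest ratio is
    the first to become tight.\<close>
  then obtain i where i: "i \<in> ?S" "\<And>j. j \<in> ?S \<Longrightarrow> c i / - e i \<le> c j / - e j"
    using ex_is_arg_min_if_finite[of ?S "\<lambda>j. c j / - e j"]
    unfolding is_arg_min_linorder by blast
  let ?t = "c i / - e i"
  have t: "0 \<le> ?t" using i(1) assms(2) by (simp add: divide_nonneg_neg)
  have "0 \<le> c j + ?t * e j" if "j \<in> I" for j
  proof (cases "e j < 0")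
    case True
    with i(2) that have "?t \<le> c j / - e j" by blast
    then have "?t * - e j \<le> c j" using True by (subst (asm) pos_le_divide_eq) auto
    then show ?thesis by linarith
  next
    case False
    then show ?thesis using t assms(2)[OF that] by (meson add_nonneg_nonneg linorder_not_le mult_nonneg_nonneg)
  qed
  moreover have "c i + ?t * e i = 0" using i(1) by simp
  ultimately show thesis using that t i(1) by blast
qed

lemma small_step:
  fixes c e :: "'i \<Rightarrow> real"
  assumes "finite I" "\<And>i. i \<in> I \<Longrightarrow> 0 \<le> c i" "\<And>i. i \<in> I \<Longrightarrow> c i = 0 \<Longrightarrow> 0 \<le> e i"
  obtains t where "0 < t" "\<And>i s. i \<in> I \<Longrightarrow> 0 \<le> s \<Longrightarrow> s \<le> t \<Longrightarrow> 0 \<le> c i + s * e i"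
proof (cases "\<exists>i\<in>I. e i < 0")
  case False
  then show thesis using assms(2) that[of 1] by (meson add_nonneg_nonneg linorder_not_le mult_nonneg_nonneg zero_less_one)
next
  case True
  then obtain i0 where i0: "i0 \<in> I" "e i0 < 0" by blast
  obtain t i where
    t: "0 \<le> t" "\<And>i. i \<in> I \<Longrightarrow> 0 \<le> c i + t * e i" and i: "i \<in> I" "e i < 0" "c i + t * e i = 0"
    using max_step[of I c i0 e, OF assms(1,2) i0] by blast
  have "t \<noteq> 0" using i assms(3)[of i] by auto
  have "0 \<le> c j + s * e j" if "j \<in> I" "0 \<le> s" "s \<le> t" for j s
  proof (cases "0 \<le> e j")
    case True
    then show ?thesis using assms(2) that by simp
  next
    case False
    then have "t * e j \<le> s * e j" using that by (simp add: mult_right_mono_neg)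
    then show ?thesis using t(2)[OF that(1)] by linarith
  qed
  with \<open>t \<noteq> 0\<close> t(1) that show thesis by (metis order_le_less)
qed

text \<open>A connectedness argument: if every \<open>g\<close> that vanishes at a point where all
  functions are nonnegative were nonnegative on the whole interval, nonnegativity of all would
  spread from 0 to \<open>T\<close>. The point \<open>t\<close> may lie on either side of
  \<open>s\<close>; it witnesses that \<open>g\<close> is not constantly zero.\<close>

lemma first_exit:
  fixes G :: "(real \<Rightarrow> real) set"
  assumes fin: "finite G" and cont: "\<forall>g\<in>G. continuous_on {0..T} g"
    and start: "\<forall>g\<in>G. 0 \<le> g 0" and exit: "g0 \<in> G" "g0 T < 0" and T: "0 \<le> T"
  obtains s g t where "s \<in> {0..T}" "\<And>h. h \<in> G \<Longrightarrow> 0 \<le> h s" "g \<in> G" "g s = 0" "t \<in> {0..T}" "g t < 0"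
proof (rule ccontr)
  note exits = that
  assume "\<not> thesis"
  have no: "0 \<le> g t" if "s \<in> {0..T}" "\<forall>h\<in>G. 0 \<le> h s" "g \<in> G" "g s = 0" "t \<in> {0..T}" for s g t
  proof (rule ccontr)
    assume "\<not> 0 \<le> g t"
    then have thesis by (intro exits[of s g t]) (use that in simp_all)
    with \<open>\<not> thesis\<close> show False ..
  qed
  let ?P = "\<lambda>s. \<forall>h\<in>G. 0 \<le> h s"
  have op: "openin (top_of_set {0..T}) {s\<in>{0..T}. 0 < g s}" "openin (top_of_set {0..T}) {s\<in>{0..T}. g s < 0}" if "g \<in> G" for g
  proof -
    have "openin (top_of_set {0..T}) ({0..T} \<inter> g -` {0<..})" "openin (top_of_set {0..T}) ({0..T} \<inter> g -` {..<0})"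
      by (rule continuous_openin_preimage_gen[OF bspec[OF cont that]], simp)+
    moreover have "{0..T} \<inter> g -` {0<..} = {s\<in>{0..T}. 0 < g s}" "{0..T} \<inter> g -` {..<0} = {s\<in>{0..T}. g s < 0}" by auto
    ultimately show "openin (top_of_set {0..T}) {s\<in>{0..T}. 0 < g s}" "openin (top_of_set {0..T}) {s\<in>{0..T}. g s < 0}" by auto
  qed
  have "?P T"
  proof (rule connected_induction_simple[of "{0..T}" 0 T ?P])
    show "connected {0..T}" "0 \<in> {0..T}" "T \<in> {0..T}" "?P 0" using T start by auto
    fix s assume s: "s \<in> {0..T}"
    show "\<exists>U. openin (top_of_set {0..T}) U \<and> s \<in> U \<and> (\<forall>x\<in>U. \<forall>y\<in>U. ?P x \<longrightarrow> ?P y)"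
    proof (cases "?P s")
      case False
      then obtain g where g: "g \<in> G" "g s < 0" by force
      have "\<not> ?P x" if "x \<in> {s\<in>{0..T}. g s < 0}" for x
        using that g(1) by (auto simp: not_le)
      moreover have "s \<in> {s\<in>{0..T}. g s < 0}" using g(2) s by simp
      ultimately show ?thesis
        by (intro exI[of _ "{s\<in>{0..T}. g s < 0}"] conjI ballI impI) (rule op(2)[OF g(1)], simp, blast)
    next
      case True
      \<comment> \<open>Functions positive at \<open>s\<close> stay positive nearby; those vanishing
        at \<open>s\<close> are nonnegative everywhere by \<open>no\<close>.\<close>
      let ?H = "{g\<in>G. 0 < g s}"
      let ?U = "\<Inter> (insert {0..T} ((\<lambda>g. {s\<in>{0..T}. 0 < g s}) ` ?H))"
      have "openin (top_of_set {0..T}) ?U"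
      proof (rule openin_Inter)
        fix U assume "U \<in> insert {0..T} ((\<lambda>g. {s\<in>{0..T}. 0 < g s}) ` ?H)"
        then show "openin (top_of_set {0..T}) U" using op(1) by fastforce
      qed (use fin in simp_all)
      moreover have "s \<in> ?U" using s by simp
      moreover have "?P y" if "y \<in> ?U" for y
      proof (rule ballI)
        fix g assume "g \<in> G"
        show "0 \<le> g y"
        proof (cases "g s = 0")
          case True
          have "y \<in> {0..T}" using that by blast
          then show ?thesis using no[OF s \<open>?P s\<close> \<open>g \<in> G\<close> True] by blast
        next
          case False
          have "0 \<le> g s" using \<open>?P s\<close> \<open>g \<in> G\<close> by blast
          then have "g \<in> ?H" using False \<open>g \<in> G\<close> by simp
          then have "y \<in> {s\<in>{0..T}. 0 < g s}" using that by blast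
          then show ?thesis by simp
        qed
      qed
      ultimately show ?thesis by (intro exI[of _ ?U] conjI ballI[of ?U] impI)
    qed
  qed
  then have "0 \<le> g0 T" using exit(1) by blast
  then show False using exit(2) by simp
qed

section \<open>Pairs without a nested triangle in special position\<close>

lemma parallelE:
  assumes "x \<times> y = 0" "x \<noteq> 0"
  obtains c where "y = c *\<^sub>R x"
  using assms by (auto simp: cross_eq_0 collinear_lemma)

text \<open>The first vertex, and below the first edge, stand for all of them by
  \<open>nested_rotate\<close> and \<open>nested_swap\<close>. A vanishing cross product instead of
  equal indices allows for zero, repeated and proportional vectors.\<close>

definition vertex_free :: "('m \<Rightarrow> real^3) \<Rightarrow> ('n \<Rightarrow> real^3) \<Rightarrow> bool" where
  "vertex_free a b \<longleftrightarrow> (\<forall>m1 m2 m3 i j. nested a b m1 m2 m3 \<longrightarrow>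
     a i \<bullet> m1 = 0 \<longrightarrow> a j \<bullet> m1 = 0 \<longrightarrow> a i \<times> a j = 0)"

definition edge_free :: "('m \<Rightarrow> real^3) \<Rightarrow> ('n \<Rightarrow> real^3) \<Rightarrow> bool" where
  "edge_free a b \<longleftrightarrow> (\<forall>m1 m2 m3 i j x y x' y'. nested a b m1 m2 m3 \<longrightarrow>
     b i = x *\<^sub>R m1 + y *\<^sub>R m2 \<longrightarrow> b j = x' *\<^sub>R m1 + y' *\<^sub>R m2 \<longrightarrow> b i \<times> b j = 0)"

locale free_pair =
  fixes a :: "'m::finite \<Rightarrow> real^3" and b :: "'n::finite \<Rightarrow> real^3"
  assumes spans_a: "spans a" and spans_b: "spans b"
    and vertex_free: "vertex_free a b" and edge_free: "edge_free a b"
begin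

lemma vertex_parallel:
  assumes "nested a b m1 m2 m3" "a i \<bullet> m1 = 0" "a j \<bullet> m1 = 0" "a i \<noteq> 0"
  obtains c where "a j = c *\<^sub>R a i"
  using assms vertex_free unfolding vertex_free_def by (meson parallelE)

lemma edge_parallel:
  assumes "nested a b m1 m2 m3" "b i = x *\<^sub>R m1 + y *\<^sub>R m2" "b j = x' *\<^sub>R m1 + y' *\<^sub>R m2" "b i \<noteq> 0"
  obtains c where "b j = c *\<^sub>R b i"
  using assms edge_free unfolding edge_free_def by (meson parallelE)

text \<open>The vertex \<open>m1\<close> moves away from \<open>m2\<close> along their edge until it
  reaches a line of the outer polygon. The cone only grows, since the old \<open>m1\<close> is the
  new one plus a nonnegative multiple of \<open>m2\<close>.\<close>

lemma push:
  assumes n: "nested a b m1 m2 m3"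
  obtains t i where "nested a b (m1 - t *\<^sub>R m2) m2 m3" "a i \<bullet> (m1 - t *\<^sub>R m2) = 0" "0 < a i \<bullet> m2"
proof -
  have nn: "0 \<le> a k \<bullet> m1" "0 \<le> a k \<bullet> m2" "0 \<le> a k \<bullet> m3" for k using n by (auto simp: nested_def)
  have "m2 \<noteq> 0" using nested_det3_nonzero[OF n spans_b] by (auto simp: det3_eq_dot_cross)
  then obtain k where "a k \<bullet> m2 \<noteq> 0" using spans_a by (auto dest: spansD)
  with nn have "- (a k \<bullet> m2) < 0" by (simp add: order_less_le)
  from max_step[of UNIV "\<lambda>k. a k \<bullet> m1" k "\<lambda>k. - (a k \<bullet> m2)", OF finite nn(1) UNIV_I this]
  obtain t i where t: "0 \<le> t" "\<And>i. 0 \<le> a i \<bullet> m1 + t * - (a i \<bullet> m2)"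
    "- (a i \<bullet> m2) < 0" "a i \<bullet> m1 + t * - (a i \<bullet> m2) = 0" by auto
  have "\<exists>x y z. 0 \<le> x \<and> 0 \<le> y \<and> 0 \<le> z \<and> b j = x *\<^sub>R (m1 - t *\<^sub>R m2) + y *\<^sub>R m2 + z *\<^sub>R m3" for j
  proof -
    obtain x y z where "0 \<le> x" "0 \<le> y" "0 \<le> z" and b: "b j = x *\<^sub>R m1 + y *\<^sub>R m2 + z *\<^sub>R m3"
      using n unfolding nested_def by blast
    then show ?thesis using t(1)
      by (intro exI[of _ x] exI[of _ "y + t * x"] exI[of _ z]) (simp add: algebra_simps)
  qed
  then have "nested a b (m1 - t *\<^sub>R m2) m2 m3"
    using t(2) nn by (simp add: nested_def inner_diff_right)
  then show thesis by (rule that) (use t in \<open>simp_all add: inner_diff_right\<close>)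
qed

text \<open>If the line \<open>a i\<close> through \<open>m1\<close> also contained
  \<open>m2\<close>, pushing \<open>m1\<close> away from \<open>m2\<close> would keep it on
  \<open>a i\<close> and bring it to a second line that misses \<open>m2\<close>, against
  \<open>vertex_free\<close>.\<close>

lemma vertex_pos:
  assumes n: "nested a b m1 m2 m3" and i: "a i \<bullet> m1 = 0" "a i \<noteq> 0"
  shows "0 < a i \<bullet> m2" "0 < a i \<bullet> m3"
proof -
  have *: "0 < a i \<bullet> m2" if n: "nested a b m1 m2 m3" for m2 m3
  proof (rule ccontr)
    assume "\<not> 0 < a i \<bullet> m2"
    with n have 0: "a i \<bullet> m2 = 0" by (auto simp: nested_def intro: antisym)
    obtain t j where t: "nested a b (m1 - t *\<^sub>R m2) m2 m3" "a j \<bullet> (m1 - t *\<^sub>R m2) = 0" "0 < a j \<bullet> m2"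
      using push[OF n] .
    have "a i \<bullet> (m1 - t *\<^sub>R m2) = 0" using i 0 by (simp add: inner_diff_right)
    from vertex_parallel[OF t(1) this t(2) i(2)] obtain c where "a j = c *\<^sub>R a i" .
    with t(3) 0 show False by simp
  qed
  show "0 < a i \<bullet> m2" "0 < a i \<bullet> m3" using *[OF n] *[OF nested_swap[OF n]] .
qed

end

section \<open>Sliding triangles in coordinates\<close>

text \<open>The vertex \<open>m\<close> on the line \<open>u\<close> moves along this line, whose second direction is its
  intersection with the line through \<open>m'\<close> and \<open>m''\<close>.\<close>

definition slide :: "real^3 \<Rightarrow> real^3 \<Rightarrow> real^3 \<Rightarrow> real^3 \<Rightarrow> real \<Rightarrow> real^3" where
  "slide u m m' m'' s = m + s *\<^sub>R ((u \<bullet> m') *\<^sub>R m'' - (u \<bullet> m'') *\<^sub>R m')"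

text \<open>Up to the determinant of the three unslid vertices, the determinant of two slid consecutive vertices and the point with
  coordinates \<open>y\<close>, \<open>y'\<close>, \<open>y''\<close> with respect to the unslid vertices.\<close>

definition edge_form :: "real \<Rightarrow> real \<Rightarrow> real \<Rightarrow> real \<Rightarrow> real \<Rightarrow> real \<Rightarrow> real \<Rightarrow> real \<Rightarrow> real \<Rightarrow> real" where
  "edge_form p q p' q' s s' y y' y'' =
     (s * s' * q * q' - s * p) * y + (s * s' * p * p' + s' * q') * y' + (1 + s * s' * q * p') * y''"

text \<open>The vertices of this nested triangle already lie on outer lines. With lines and
  coordinates as parameters, rotated and mirrored copies can be interpreted, so that statements are
  proved for one vertex or edge only.\<close>

locale frame = free_pair a b for a :: "'m::finite \<Rightarrow> real^3" and b :: "'n::finite \<Rightarrow> real^3" +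
  fixes m1 m2 m3 :: "real^3" and y1 y2 y3 :: "'n \<Rightarrow> real" and i1 i2 i3 :: 'm
  assumes am: "0 \<le> a k \<bullet> m1" "0 \<le> a k \<bullet> m2" "0 \<le> a k \<bullet> m3"
    and y: "0 \<le> y1 j" "0 \<le> y2 j" "0 \<le> y3 j"
    and b: "b j = y1 j *\<^sub>R m1 + y2 j *\<^sub>R m2 + y3 j *\<^sub>R m3"
    and a0: "a i1 \<bullet> m1 = 0" "a i2 \<bullet> m2 = 0" "a i3 \<bullet> m3 = 0"
    and anz: "a i1 \<noteq> 0" "a i2 \<noteq> 0" "a i3 \<noteq> 0"
begin

lemma nested: "nested a b m1 m2 m3"
  unfolding nested_def using am y b by blast

lemma rotated: "frame a b m2 m3 m1 y2 y3 y1 i2 i3 i1"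
proof unfold_locales
  show "b j = y2 j *\<^sub>R m2 + y3 j *\<^sub>R m3 + y1 j *\<^sub>R m1" for j using b[of j] by simp
qed (use am y a0 anz in auto)

text \<open>Exchanging \<open>m2\<close> and \<open>m3\<close> reverses the sign of the slide
  parameters.\<close>

lemma mirrored: "frame a b m1 m3 m2 y1 y3 y2 i1 i3 i2"
proof unfold_locales
  show "b j = y1 j *\<^sub>R m1 + y3 j *\<^sub>R m3 + y2 j *\<^sub>R m2" for j using b[of j] by simp
qed (use am y a0 anz in auto)

text \<open>In cyclic order, \<open>p\<close> is the value of the line through a vertex at the next
  vertex and \<open>q\<close> its value at the previous one.\<close>

definition "p1 = a i1 \<bullet> m2"
definition "q1 = a i1 \<bullet> m3"
definition "p2 = a i2 \<bullet> m3"
definition "q2 = a i2 \<bullet> m1"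
definition "p3 = a i3 \<bullet> m1"
definition "q3 = a i3 \<bullet> m2"

lemmas pq_defs = p1_def q1_def p2_def q2_def p3_def q3_def

lemma pq_pos: "0 < p1" "0 < q1" "0 < p2" "0 < q2" "0 < p3" "0 < q3"
  unfolding pq_defs
  using vertex_pos[OF nested a0(1) anz(1)] vertex_pos[OF nested_rotate[OF nested] a0(2) anz(2)]
    vertex_pos[OF nested_rotate[OF nested_rotate[OF nested]] a0(3) anz(3)] by auto

abbreviation "M1 \<equiv> slide (a i1) m1 m2 m3"
abbreviation "M2 \<equiv> slide (a i2) m2 m3 m1"
abbreviation "M3 \<equiv> slide (a i3) m3 m1 m2"

abbreviation "E12 s s' j \<equiv> edge_form p1 q1 p2 q2 s s' (y1 j) (y2 j) (y3 j)"
abbreviation "E23 s s' j \<equiv> edge_form p2 q2 p3 q3 s s' (y2 j) (y3 j) (y1 j)"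
abbreviation "E31 s s' j \<equiv> edge_form p3 q3 p1 q1 s s' (y3 j) (y1 j) (y2 j)"

text \<open>Only weak inequalities occur, so that the set is closed; that the slid vertices keep
  their orientation is derived in \<open>slide_det_pos\<close>.\<close>

definition "admissible s1 s2 s3 \<longleftrightarrow>
  (\<forall>k. 0 \<le> a k \<bullet> M1 s1) \<and> (\<forall>k. 0 \<le> a k \<bullet> M2 s2) \<and> (\<forall>k. 0 \<le> a k \<bullet> M3 s3) \<and>
  (\<forall>j. 0 \<le> E12 s1 s2 j) \<and> (\<forall>j. 0 \<le> E23 s2 s3 j) \<and> (\<forall>j. 0 \<le> E31 s3 s1 j)"

text \<open>The determinant of the slid vertices divided by that of the unslid ones.\<close>

definition "slide_det s1 s2 s3 = 1 + s1 * s2 * q1 * p2 + s2 * s3 * q2 * p3 + s3 * s1 * q3 * p1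
   + s1 * s2 * s3 * (p1 * p2 * p3 - q1 * q2 * q3)"

lemma M_eq:
  "M1 s = m1 - (s * q1) *\<^sub>R m2 + (s * p1) *\<^sub>R m3"
  "M2 s = m2 - (s * q2) *\<^sub>R m3 + (s * p2) *\<^sub>R m1"
  "M3 s = m3 - (s * q3) *\<^sub>R m1 + (s * p3) *\<^sub>R m2"
  by (simp_all add: slide_def pq_defs algebra_simps)

lemma a_M:
  "a k \<bullet> M1 s = a k \<bullet> m1 + s * (p1 * (a k \<bullet> m3) - q1 * (a k \<bullet> m2))"
  "a k \<bullet> M2 s = a k \<bullet> m2 + s * (p2 * (a k \<bullet> m1) - q2 * (a k \<bullet> m3))"
  "a k \<bullet> M3 s = a k \<bullet> m3 + s * (p3 * (a k \<bullet> m2) - q3 * (a k \<bullet> m1))"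
  by (simp_all add: M_eq inner_add_right inner_diff_right algebra_simps)

text \<open>Nonnegativity of these values bounds each slide parameter on both sides.\<close>

lemma ai_M:
  "a i1 \<bullet> M1 s = 0" "a i1 \<bullet> M2 s = p1 - s * q2 * q1" "a i1 \<bullet> M3 s = q1 + s * p3 * p1"
  "a i2 \<bullet> M2 s = 0" "a i2 \<bullet> M3 s = p2 - s * q3 * q2" "a i2 \<bullet> M1 s = q2 + s * p1 * p2"
  "a i3 \<bullet> M3 s = 0" "a i3 \<bullet> M1 s = p3 - s * q1 * q3" "a i3 \<bullet> M2 s = q3 + s * p2 * p3"
  unfolding a_M a0 pq_defs[symmetric] by (simp_all add: algebra_simps)

text \<open>Cramer's rule for the slid vertices, with all determinants divided by that of the unslid
  ones.\<close>

lemma slide_combination: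
  "slide_det s1 s2 s3 *\<^sub>R b j = E23 s2 s3 j *\<^sub>R M1 s1 + E31 s3 s1 j *\<^sub>R M2 s2 + E12 s1 s2 j *\<^sub>R M3 s3"
proof -
  let ?D = "slide_det s1 s2 s3"
  have c: "?D * y1 j = E23 s2 s3 j + E31 s3 s1 j * (s2 * p2) - E12 s1 s2 j * (s3 * q3)"
    "?D * y2 j = E31 s3 s1 j + E12 s1 s2 j * (s3 * p3) - E23 s2 s3 j * (s1 * q1)"
    "?D * y3 j = E12 s1 s2 j + E23 s2 s3 j * (s1 * p1) - E31 s3 s1 j * (s2 * q2)"
    by (simp_all add: slide_det_def edge_form_def algebra_simps)
  show ?thesis
    unfolding M_eq b[of j] scaleR_right_distrib scaleR_right_diff_distrib scaleR_scaleR c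
    by (simp add: algebra_simps)
qed

lemma coordinates_independent:
  assumes "\<And>j. x1 * y1 j + x2 * y2 j + x3 * y3 j = 0"
  shows "x1 = 0" "x2 = 0" "x3 = 0"
proof -
  let ?d = "det3 m1 m2 m3"
  have d: "?d \<noteq> 0" using nested_det3_nonzero[OF nested spans_b] .
  define w where "w = x1 *\<^sub>R (m2 \<times> m3) + x2 *\<^sub>R (m3 \<times> m1) + x3 *\<^sub>R (m1 \<times> m2)"
  have e: "m1 \<bullet> (m2 \<times> m3) = ?d" "m2 \<bullet> (m3 \<times> m1) = ?d" "m3 \<bullet> (m1 \<times> m2) = ?d"
    by (simp_all add: det3_eq_dot_cross cross3_simps)
  have m: "m1 \<bullet> w = x1 * ?d" "m2 \<bullet> w = x2 * ?d" "m3 \<bullet> w = x3 * ?d"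
    by (simp_all add: w_def inner_add_right dot_cross_self e)
  have "b j \<bullet> w = 0" for j
  proof -
    have "b j \<bullet> w = (x1 * y1 j + x2 * y2 j + x3 * y3 j) * ?d"
      by (simp add: b[of j] inner_add_left m algebra_simps)
    then show ?thesis using assms by simp
  qed
  then have "w = 0" using spans_b by (auto simp: spans_def)
  with m d show "x1 = 0" "x2 = 0" "x3 = 0" by auto
qed

lemma coordinates_eq:
  assumes "b j = x1 *\<^sub>R m1 + x2 *\<^sub>R m2 + x3 *\<^sub>R m3"
  shows "y1 j = x1" "y2 j = x2" "y3 j = x3"
proof -
  have "y1 j * det3 m1 m2 m3 = x1 * det3 m1 m2 m3" "y2 j * det3 m1 m2 m3 = x2 * det3 m1 m2 m3"
    "y3 j * det3 m1 m2 m3 = x3 * det3 m1 m2 m3"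
    using arg_cong[OF trans[OF b[symmetric] assms], of "\<lambda>v. det3 v m2 m3"]
      arg_cong[OF trans[OF b[symmetric] assms], of "\<lambda>v. det3 m1 v m3"]
      arg_cong[OF trans[OF b[symmetric] assms], of "\<lambda>v. det3 m1 m2 v"]
    by (simp_all add: det3_add det3_scaleR)
  then show "y1 j = x1" "y2 j = x2" "y3 j = x3"
    using nested_det3_nonzero[OF nested spans_b] by auto
qed

lemma coordinates_parallel:
  assumes "b j' = c *\<^sub>R b j"
  shows "y1 j' = c * y1 j" "y2 j' = c * y2 j" "y3 j' = c * y3 j"
  by (rule coordinates_eq; simp add: assms b[of j] algebra_simps)+

text \<open>Pairing \<open>slide_combination\<close> with a line gives a nonnegative right-hand
  side, and some \<open>a k \<bullet> b j\<close> is positive, so only the value 0 must be excluded.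
  There all edge forms would vanish identically, which forces the three parameters to have pairwise
  opposite signs.\<close>

lemma slide_det_pos:
  assumes "admissible s1 s2 s3"
  shows "0 < slide_det s1 s2 s3"
proof -
  let ?D = "slide_det s1 s2 s3"
  note ad = assms[unfolded admissible_def]
  have eq: "?D * (a k \<bullet> b j) = E23 s2 s3 j * (a k \<bullet> M1 s1) + E31 s3 s1 j * (a k \<bullet> M2 s2) + E12 s1 s2 j * (a k \<bullet> M3 s3)" for k j
    using arg_cong[OF slide_combination[of s1 s2 s3 j], of "\<lambda>v. a k \<bullet> v"]
    by (simp add: inner_add_right)
  obtain j where "b j \<noteq> 0" using spans_b unfolding spans_def
    by (metis cross_basis_nonzero(1) inner_zero_left zero_neq_one axis_eq_0_iff)
  then obtain k where "a k \<bullet> b j \<noteq> 0" using spans_a by (auto dest: spansD)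
  then have pos: "0 < a k \<bullet> b j" using nested_imp_dual_nonneg[OF nested] by (simp add: order_less_le)
  have "0 \<le> ?D * (a k \<bullet> b j)" unfolding eq using ad by (intro add_nonneg_nonneg mult_nonneg_nonneg) auto
  with pos have "0 \<le> ?D" by (simp add: zero_le_mult_iff)
  moreover have "?D \<noteq> 0"
  proof
    assume D: "?D = 0"
    have z: "E23 s2 s3 j * (a k \<bullet> M1 s1) = 0" "E31 s3 s1 j * (a k \<bullet> M2 s2) = 0" "E12 s1 s2 j * (a k \<bullet> M3 s3) = 0" for k j
    proof -
      have "0 \<le> E23 s2 s3 j * (a k \<bullet> M1 s1)" "0 \<le> E31 s3 s1 j * (a k \<bullet> M2 s2)" "0 \<le> E12 s1 s2 j * (a k \<bullet> M3 s3)"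
        using ad by (auto intro!: mult_nonneg_nonneg)
      moreover have "E23 s2 s3 j * (a k \<bullet> M1 s1) + E31 s3 s1 j * (a k \<bullet> M2 s2) + E12 s1 s2 j * (a k \<bullet> M3 s3) = 0"
        unfolding eq[symmetric] D by simp
      ultimately show "E23 s2 s3 j * (a k \<bullet> M1 s1) = 0" "E31 s3 s1 j * (a k \<bullet> M2 s2) = 0"
        "E12 s1 s2 j * (a k \<bullet> M3 s3) = 0" by linarith+
    qed
    \<comment> \<open>No \<open>s\<close> makes two values such as \<open>q1 + s * p3 * p1\<close>
      and \<open>p2 - s * q3 * q2\<close> vanish together: one needs a negative, the other a
      positive \<open>s\<close>.\<close>
    have key: "s * u * v \<noteq> w \<or> s * u' * v' \<noteq> - w'" if "0 < u" "0 < v" "0 < w" "0 < u'" "0 < v'" "0 < w'" for s u v w u' v' w' :: real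
    proof (rule ccontr)
      assume "\<not> ?thesis"
      then have "0 < s * (u * v)" "s * (u' * v') < 0" using that by (simp_all add: mult.assoc)
      then show False using that by (simp add: zero_less_mult_iff mult_less_0_iff)
    qed
    have 1: "E12 s1 s2 j = 0" for j
      using z(3)[where k = i1 and j = j] z(3)[where k = i2 and j = j] pq_pos key[of q3 q2 p2 p3 p1 q1 s3] unfolding ai_M by auto
    have 2: "E23 s2 s3 j = 0" for j
      using z(1)[where k = i2 and j = j] z(1)[where k = i3 and j = j] pq_pos key[of q1 q3 p3 p1 p2 q2 s1] unfolding ai_M by auto
    have 3: "E31 s3 s1 j = 0" for j
      using z(2)[where k = i3 and j = j] z(2)[where k = i1 and j = j] pq_pos key[of q2 q1 p1 p2 p3 q3 s2] unfolding ai_M by auto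
    \<comment> \<open>The coordinate functions are independent, so every coefficient of an
      identically vanishing edge form is zero; the one of the opposite vertex is used.\<close>
    have e1: "1 + s1 * s2 * q1 * p2 = 0"
      by (rule coordinates_independent(3)[OF 1[unfolded edge_form_def]])
    have e2: "1 + s2 * s3 * q2 * p3 = 0"
      by (rule coordinates_independent(1)[of _ "s2 * s3 * q2 * q3 - s2 * p2" "s2 * s3 * p2 * p3 + s3 * q3"])
        (use 2 in \<open>simp add: edge_form_def algebra_simps\<close>)
    have e3: "1 + s3 * s1 * q3 * p1 = 0"
      by (rule coordinates_independent(2)[of "s3 * s1 * p3 * p1 + s1 * q1" _ "s3 * s1 * q3 * q1 - s3 * p3"])
        (use 3 in \<open>simp add: edge_form_def algebra_simps\<close>)
    have neg: "u < 0" if "1 + u * v * w = 0" "0 < v" "0 < w" for u v w :: real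
    proof -
      have "u * (v * w) < 0" using that(1) by (simp add: mult.assoc)
      then show ?thesis using that by (simp add: mult_less_0_iff)
    qed
    have "s1 * s2 < 0" "s2 * s3 < 0" "s3 * s1 < 0"
      using neg[OF e1] neg[OF e2] neg[OF e3] pq_pos by auto
    then show False by (auto simp: mult_less_0_iff)
  qed
  ultimately show ?thesis by simp
qed

lemma admissible_combination:
  assumes "admissible s1 s2 s3"
  shows "b j = (E23 s2 s3 j / slide_det s1 s2 s3) *\<^sub>R M1 s1 + (E31 s3 s1 j / slide_det s1 s2 s3) *\<^sub>R M2 s2
    + (E12 s1 s2 j / slide_det s1 s2 s3) *\<^sub>R M3 s3"
proof -
  let ?D = "slide_det s1 s2 s3"
  have "b j = (1 / ?D) *\<^sub>R (?D *\<^sub>R b j)" using slide_det_pos[OF assms] by simp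
  then show ?thesis unfolding slide_combination by (simp add: scaleR_right_distrib)
qed

lemma admissible_nested:
  assumes "admissible s1 s2 s3"
  shows "nested a b (M1 s1) (M2 s2) (M3 s3)"
proof -
  have "0 \<le> E23 s2 s3 j / slide_det s1 s2 s3 \<and> 0 \<le> E31 s3 s1 j / slide_det s1 s2 s3 \<and> 0 \<le> E12 s1 s2 j / slide_det s1 s2 s3" for j
    using assms slide_det_pos[OF assms] by (auto simp: admissible_def)
  with assms admissible_combination[OF assms] show ?thesis
    unfolding nested_def admissible_def by blast
qed

text \<open>Nothing blocks a short slide of \<open>M1\<close>: lines that are tight at
  \<open>M1\<close> are multiples of \<open>a i1\<close>, along which it moves, the edge to
  \<open>M2\<close> has no contact, and at a point on the edge from \<open>M3\<close> the edge form
  does not decrease.\<close>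

lemma admissible_increase:
  assumes ad: "admissible s1 s2 s3" and E: "\<And>j. b j \<noteq> 0 \<Longrightarrow> 0 < E12 s1 s2 j"
  obtains t where "0 < t" "admissible (s1 + t) s2 s3"
proof -
  note ad' = ad[unfolded admissible_def]
  \<comment> \<open>Each affected inequality is affine in \<open>s1\<close>; these are the
    slopes.\<close>
  let ?e1 = "\<lambda>k. p1 * (a k \<bullet> m3) - q1 * (a k \<bullet> m2)"
  let ?e2 = "\<lambda>j. (s2 * q1 * q2 - p1) * y1 j + s2 * p1 * p2 * y2 j + s2 * q1 * p2 * y3 j"
  let ?e3 = "\<lambda>j. s3 * q3 * q1 * y3 j + (q1 + s3 * p3 * p1) * y1 j + s3 * q3 * p1 * y2 j"
  have "0 \<le> ?e1 k" if 0: "a k \<bullet> M1 s1 = 0" for k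
  proof -
    obtain c where "a k = c *\<^sub>R a i1"
      using vertex_parallel[OF admissible_nested[OF ad] ai_M(1) 0 anz(1)] .
    then show ?thesis by (simp add: p1_def q1_def)
  qed
  then obtain t1 where t1: "0 < t1" "\<And>k s. 0 \<le> s \<Longrightarrow> s \<le> t1 \<Longrightarrow> 0 \<le> a k \<bullet> M1 s1 + s * ?e1 k"
    using small_step[of UNIV "\<lambda>k. a k \<bullet> M1 s1" ?e1] ad' by auto
  have "0 \<le> ?e2 j" if "E12 s1 s2 j = 0" for j
  proof -
    have "b j = 0" using E[of j] that by force
    then show ?thesis using coordinates_eq[of j 0 0 0] by simp
  qed
  then obtain t2 where t2: "0 < t2" "\<And>j s. 0 \<le> s \<Longrightarrow> s \<le> t2 \<Longrightarrow> 0 \<le> E12 s1 s2 j + s * ?e2 j"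
    using small_step[of UNIV "\<lambda>j. E12 s1 s2 j" ?e2] ad' by auto
  have "0 \<le> ?e3 j" if "E31 s3 s1 j = 0" for j
  proof -
    \<comment> \<open>Where \<open>E31\<close> vanishes, its slope is, up to a positive factor,
      \<open>E23\<close> times the value of \<open>a i1\<close> at \<open>M3 s3\<close>.\<close>
    have "slide_det s1 s2 s3 * ?e3 j = E23 s2 s3 j * (q1 + s3 * p3 * p1)
      + E31 s3 s1 j * (s2 * p2 * (s3 * p3 * p1 + q1) + s3 * q3 * p1 - s2 * q2 * s3 * q3 * q1)"
      by (simp add: slide_det_def edge_form_def algebra_simps)
    moreover have "0 \<le> E23 s2 s3 j * (q1 + s3 * p3 * p1)"
      using ad' ai_M(3)[of s3] by (metis mult_nonneg_nonneg)
    ultimately have "0 \<le> slide_det s1 s2 s3 * ?e3 j" using that by simp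
    then show ?thesis using slide_det_pos[OF ad] by (simp only: zero_le_mult_iff) linarith
  qed
  then obtain t3 where t3: "0 < t3" "\<And>j s. 0 \<le> s \<Longrightarrow> s \<le> t3 \<Longrightarrow> 0 \<le> E31 s3 s1 j + s * ?e3 j"
    using small_step[of UNIV "\<lambda>j. E31 s3 s1 j" ?e3] ad' by auto
  define t where "t = min t1 (min t2 t3)"
  have t: "0 < t" "t \<le> t1" "t \<le> t2" "t \<le> t3" using t1 t2 t3 by (auto simp: t_def)
  have "a k \<bullet> M1 (s1 + t) = a k \<bullet> M1 s1 + t * ?e1 k" for k
    unfolding a_M by (simp add: algebra_simps)
  then have "0 \<le> a k \<bullet> M1 (s1 + t)" for k using t1(2)[of t k] t by simp
  moreover have "E12 (s1 + t) s2 j = E12 s1 s2 j + t * ?e2 j" for j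
    by (simp add: edge_form_def algebra_simps)
  then have "0 \<le> E12 (s1 + t) s2 j" for j using t2(2)[of t j] t by simp
  moreover have "E31 s3 (s1 + t) j = E31 s3 s1 j + t * ?e3 j" for j
    by (simp add: edge_form_def algebra_simps)
  then have "0 \<le> E31 s3 (s1 + t) j" for j using t3(2)[of t j] t by simp
  ultimately have "admissible (s1 + t) s2 s3" using ad' unfolding admissible_def by blast
  then show thesis using t(1) that by blast
qed

section \<open>Triangles all of whose edges touch the inner polygon\<close>

definition "touching s1 s2 s3 \<longleftrightarrow>
  (\<exists>j. b j \<noteq> 0 \<and> E12 s1 s2 j = 0) \<and> (\<exists>j. b j \<noteq> 0 \<and> E23 s2 s3 j = 0) \<and> (\<exists>j. b j \<noteq> 0 \<and> E31 s3 s1 j = 0)"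

lemma compact_admissible: "compact {(s1, s2, s3). admissible s1 s2 s3}"
proof -
  let ?K = "{(s1, s2, s3). admissible s1 s2 s3}"
  have K: "?K = {s. admissible (fst s) (fst (snd s)) (snd (snd s))}" by auto
  have "closed {s. admissible (fst s) (fst (snd s)) (snd (snd s))}"
    unfolding admissible_def a_M edge_form_def
    by (intro closed_Collect_conj closed_Collect_all closed_Collect_le continuous_intros)
  then have "closed ?K" unfolding K .
  moreover have "?K \<subseteq> Sigma {- (q2 / (p1 * p2)) .. p3 / (q1 * q3)} (\<lambda>_. Sigma {- (q3 / (p2 * p3)) .. p1 / (q2 * q1)} (\<lambda>_. {- (q1 / (p3 * p1)) .. p2 / (q3 * q2)}))"
  proof clarify
    fix s1 s2 s3 assume "admissible s1 s2 s3"
    then have ad: "\<And>k. 0 \<le> a k \<bullet> M1 s1" "\<And>k. 0 \<le> a k \<bullet> M2 s2" "\<And>k. 0 \<le> a k \<bullet> M3 s3"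
      by (auto simp: admissible_def)
    have up: "s \<le> u / (v * w)" if "0 \<le> u - s * v * w" "0 < v" "0 < w" for s u v w :: real
      using that by (simp add: pos_le_divide_eq mult.assoc)
    have lo: "- (u / (v * w)) \<le> s" if "0 \<le> u + s * v * w" "0 < v" "0 < w" for s u v w :: real
      using up[of u "- s" v w] that by simp
    show "s1 \<in> {- (q2 / (p1 * p2)) .. p3 / (q1 * q3)} \<and> (s2, s3) \<in> Sigma {- (q3 / (p2 * p3)) .. p1 / (q2 * q1)} (\<lambda>_. {- (q1 / (p3 * p1)) .. p2 / (q3 * q2)})"
      using ad(1)[of i2] ad(1)[of i3] ad(2)[of i3] ad(2)[of i1] ad(3)[of i1] ad(3)[of i2] pq_pos
      unfolding ai_M by (auto intro: up lo)
  qed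
  then have "bounded ?K"
    by (rule bounded_subset[rotated]) (intro bounded_Times bounded_closed_interval)
  ultimately show ?thesis by (simp add: compact_eq_bounded_closed)
qed

lemma rotated_admissible:
  "frame.admissible a m2 m3 m1 y2 y3 y1 i2 i3 i1 s2 s3 s1 = admissible s1 s2 s3"
proof -
  interpret rot: frame a b m2 m3 m1 y2 y3 y1 i2 i3 i1 by (rule rotated)
  have "rot.p1 = p2" "rot.p2 = p3" "rot.p3 = p1" "rot.q1 = q2" "rot.q2 = q3" "rot.q3 = q1"
    by (simp_all add: pq_defs rot.pq_defs)
  then show ?thesis unfolding admissible_def rot.admissible_def by auto
qed

lemma rotated_edge:
  "edge_form (frame.p1 a m3 i2) (frame.q1 a m1 i2) (frame.p2 a m1 i3) (frame.q2 a m2 i3) s2 s3 (y2 j) (y3 j) (y1 j) = E23 s2 s3 j"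
proof -
  interpret rot: frame a b m2 m3 m1 y2 y3 y1 i2 i3 i1 by (rule rotated)
  show ?thesis by (simp add: pq_defs rot.pq_defs)
qed

text \<open>The sum of the parameters is maximized over the compact admissible set; an edge without
  contact would let one of them grow further.\<close>

lemma exists_touching: "\<exists>s1 s2 s3. admissible s1 s2 s3 \<and> touching s1 s2 s3"
proof -
  interpret rot: frame a b m2 m3 m1 y2 y3 y1 i2 i3 i1 by (rule rotated)
  interpret rot2: frame a b m3 m1 m2 y3 y1 y2 i3 i1 i2 by (rule rot.rotated)
  let ?K = "{(s1, s2, s3). admissible s1 s2 s3}"
  have "admissible 0 0 0"
    unfolding admissible_def using am y by (simp add: slide_def edge_form_def)
  then have "?K \<noteq> {}" by blast
  moreover have "continuous_on ?K (\<lambda>s. fst s + fst (snd s) + snd (snd s))"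
    by (intro continuous_intros)
  ultimately obtain s where s: "s \<in> ?K"
    "\<And>s'. s' \<in> ?K \<Longrightarrow> fst s' + fst (snd s') + snd (snd s') \<le> fst s + fst (snd s) + snd (snd s)"
    using continuous_attains_sup[OF compact_admissible] by blast
  obtain s1 s2 s3 where [simp]: "s = (s1, s2, s3)" by (metis surj_pair)
  have ad: "admissible s1 s2 s3" using s(1) by simp
  have max: "s1' + s2' + s3' \<le> s1 + s2 + s3" if "admissible s1' s2' s3'" for s1' s2' s3'
    using s(2)[of "(s1', s2', s3')"] that by simp
  have "\<exists>j. b j \<noteq> 0 \<and> E12 s1 s2 j = 0"
  proof (rule ccontr)
    assume "\<not> ?thesis"
    then have "0 < E12 s1 s2 j" if "b j \<noteq> 0" for j
      using ad that unfolding admissible_def by (metis order_less_le)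
    then obtain t where "0 < t" "admissible (s1 + t) s2 s3" using admissible_increase[OF ad] by blast
    then show False using max by force
  qed
  moreover have "\<exists>j. b j \<noteq> 0 \<and> E23 s2 s3 j = 0"
  proof (rule ccontr)
    assume "\<not> ?thesis"
    then have "0 < rot.E12 s2 s3 j" if "b j \<noteq> 0" for j
      using ad that unfolding admissible_def rotated_edge by (metis order_less_le)
    then obtain t where "0 < t" "rot.admissible (s2 + t) s3 s1"
      using rot.admissible_increase[of s2 s3 s1] ad rotated_admissible by blast
    then show False using max[of s1 "s2 + t" s3] rotated_admissible by force
  qed
  moreover have "\<exists>j. b j \<noteq> 0 \<and> E31 s3 s1 j = 0"
  proof (rule ccontr)
    assume "\<not> ?thesis"
    moreover have "rot2.E12 s3 s1 j = E31 s3 s1 j" for j by (simp add: pq_defs rot2.pq_defs)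
    ultimately have "0 < rot2.E12 s3 s1 j" if "b j \<noteq> 0" for j
      using ad that unfolding admissible_def by (metis order_less_le)
    then obtain t where "0 < t" "rot2.admissible (s3 + t) s1 s2"
      using rot2.admissible_increase[of s3 s1 s2] ad rotated_admissible rot.rotated_admissible by blast
    then show False using max[of s1 s2 "s3 + t"] rotated_admissible rot.rotated_admissible by force
  qed
  ultimately show ?thesis using ad unfolding touching_def by blast
qed

lemma touching_frame:
  obtains n1 n2 n3 z1 z2 z3 j1 j2 j3 where "frame a b n1 n2 n3 z1 z2 z3 i1 i2 i3"
    "b j1 \<noteq> 0" "b j2 \<noteq> 0" "b j3 \<noteq> 0" "z1 j1 = 0" "z2 j2 = 0" "z3 j3 = 0"
proof -
  obtain s1 s2 s3 where ad: "admissible s1 s2 s3" and "touching s1 s2 s3" using exists_touching by blast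
  then obtain j1 j2 j3 where j: "b j1 \<noteq> 0" "b j2 \<noteq> 0" "b j3 \<noteq> 0"
    "E23 s2 s3 j1 = 0" "E31 s3 s1 j2 = 0" "E12 s1 s2 j3 = 0" unfolding touching_def by blast
  let ?D = "slide_det s1 s2 s3"
  have "frame a b (M1 s1) (M2 s2) (M3 s3) (\<lambda>j. E23 s2 s3 j / ?D) (\<lambda>j. E31 s3 s1 j / ?D) (\<lambda>j. E12 s1 s2 j / ?D) i1 i2 i3"
    by unfold_locales (use ad slide_det_pos[OF ad] anz in \<open>auto simp: admissible_def ai_M intro: admissible_combination[OF ad]\<close>)
  then show thesis by (rule that[OF _ j(1-3)]) (use j in auto)
qed

text \<open>Suppose an inner point sits at \<open>m1\<close>. The vertex \<open>m2\<close> slides on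
  its line, turning the edge about \<open>m1\<close>, until \<open>m2\<close> meets another line or
  the edge another inner point. The former contradicts \<open>vertex_free\<close>, the latter
  \<open>edge_free\<close>.\<close>

lemma no_vertex_contact:
  assumes 0: "y2 j = 0" "y3 j = 0"
  shows "b j = 0"
proof (rule ccontr)
  assume bj: "b j \<noteq> 0"
  let ?d = "q2 *\<^sub>R m3 - p2 *\<^sub>R m1"
  \<comment> \<open>The sum type collects the conditions for outer lines and inner points into one
    family for \<open>max_step\<close>.\<close>
  let ?c = "case_sum (\<lambda>k. a k \<bullet> m2) (\<lambda>j. y3 j)"
  let ?e = "case_sum (\<lambda>k. a k \<bullet> ?d) (\<lambda>j. - (q2 * y2 j))"
  have "0 \<le> ?c i" for i using am y by (cases i) auto
  moreover have "?e (Inl i3) < 0"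
    using pq_pos a0 by (simp add: inner_diff_right flip: p3_def)
  ultimately obtain t i where t: "0 \<le> t" "\<And>i. 0 \<le> ?c i + t * ?e i" and i: "?e i < 0" "?c i + t * ?e i = 0"
    using max_step[of "UNIV :: ('m + 'n) set" ?c "Inl i3" ?e] by auto
  let ?m = "m2 + t *\<^sub>R ?d"
  have am': "a k \<bullet> ?m = ?c (Inl k) + t * ?e (Inl k)" for k by (simp add: inner_add_right)
  have b': "b l = (y1 l + t * p2 * y2 l) *\<^sub>R m1 + y2 l *\<^sub>R ?m + (?c (Inr l) + t * ?e (Inr l)) *\<^sub>R m3" for l
    unfolding b[of l] by (simp add: algebra_simps)
  have "\<exists>x y z. 0 \<le> x \<and> 0 \<le> y \<and> 0 \<le> z \<and> b l = x *\<^sub>R m1 + y *\<^sub>R ?m + z *\<^sub>R m3" for l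
    using b'[of l] y t pq_pos(3) by (intro exI conjI) (auto simp del: sum.case)
  then have n: "nested a b m1 ?m m3"
    unfolding nested_def am' using am t(2) by blast
  show False
  proof (cases i)
    case (Inl k)
    have "a i2 \<bullet> ?m = 0" using a0 by (simp add: inner_add_right inner_diff_right q2_def p2_def)
    moreover have "a k \<bullet> ?m = 0" using i(2) unfolding am' Inl .
    ultimately obtain c where "a k = c *\<^sub>R a i2"
      using vertex_parallel[OF nested_rotate[OF n]] anz(2) by blast
    then show False using i(1) by (simp add: Inl inner_diff_right q2_def p2_def)
  next
    case (Inr l)
    have "b j = y1 j *\<^sub>R m1 + 0 *\<^sub>R ?m" using b[of j] 0 by simp
    moreover have "b l = (y1 l + t * p2 * y2 l) *\<^sub>R m1 + y2 l *\<^sub>R ?m"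
      using b'[of l] i(2) unfolding Inr by simp
    ultimately obtain c where "b l = c *\<^sub>R b j" using edge_parallel[OF n] bj by blast
    then have "y2 l = 0" using coordinates_parallel(2) 0 by simp
    then show False using i(1) by (simp add: Inr)
  qed
qed

end

section \<open>Sliding with fixed points of contact\<close>

lemma edge_form_scale: "edge_form p q p' q' s s' (c * y) (c * y') (c * y'') = c * edge_form p q p' q' s s' y y' y''"
  by (simp add: edge_form_def algebra_simps)

text \<open>The slide parameter of the next vertex when the common edge keeps passing through a given
  point.\<close>

definition next_param :: "real \<Rightarrow> real \<Rightarrow> real \<Rightarrow> real \<Rightarrow> real" where
  "next_param u v w s = u * s / (v + w * s)"

text \<open>For positive \<open>s\<close>, the reciprocal of the result is \<open>v / u\<close>
  times that of \<open>s\<close> plus \<open>w / u\<close>; dropping this nonnegative constant gives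
  the linear bound.\<close>

lemma next_param:
  assumes "0 < u" "0 < v" "0 \<le> w" "0 \<le> s"
  shows "0 \<le> next_param u v w s" "next_param u v w s \<le> u / v * s"
    "next_param u v w s * (v + w * s) = u * s"
proof -
  have "0 < v + w * s" using assms by (simp add: add_pos_nonneg)
  then show "0 \<le> next_param u v w s" "next_param u v w s * (v + w * s) = u * s"
    using assms by (auto simp: next_param_def)
  have "u * s / (v + w * s) \<le> u * s / v"
    using assms by (intro divide_left_mono mult_pos_pos add_pos_nonneg) auto
  then show "next_param u v w s \<le> u / v * s" by (simp add: next_param_def)
qed

lemma continuous_on_next_param:
  assumes "continuous_on S f" "\<And>s. s \<in> S \<Longrightarrow> 0 \<le> f s" "0 < v" "0 \<le> w"
  shows "continuous_on S (\<lambda>s. next_param u v w (f s))"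
proof -
  have "v + w * f s \<noteq> 0" if "s \<in> S" for s
    using assms(2)[OF that] assms(3,4) by (metis add_pos_nonneg less_irrefl mult_nonneg_nonneg)
  then show ?thesis unfolding next_param_def by (intro continuous_intros assms) auto
qed

text \<open>The contact point lies on the unslid edge, so its third coordinate is 0 and the form
  reduces to \<open>s' * (v + w * s) - u * s\<close>, where \<open>s'\<close> is the next
  parameter.\<close>

lemma edge_form_next_param:
  assumes "0 < u" "0 < v" "0 \<le> w" "0 \<le> s" "u = p * y" "v = q' * y'" "w = q * q' * y + p * p' * y'"
  shows "edge_form p q p' q' s (next_param u v w s) y y' 0 = 0"
proof -
  have "edge_form p q p' q' s (next_param u v w s) y y' 0 = next_param u v w s * (v + w * s) - u * s"
    unfolding assms(5-7) by (simp add: edge_form_def algebra_simps)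
  then show ?thesis using next_param(3)[OF assms(1-4)] by simp
qed

context frame
begin

text \<open>The last hypothesis bounds the product of the rates of the three steps by 1, so a full
  turn does not increase the parameter and the triangle stays nested up to the first new contact.
  This must occur before \<open>T\<close>, yet what causes it is proportional to a line or point
  already in contact, for which nothing changes during the slide.\<close>

lemma slide_back_contradiction:
  assumes j: "y1 j1 = 0" "y2 j2 = 0" "y3 j3 = 0"
    and pos: "0 < y2 j1" "0 < y3 j1" "0 < y3 j2" "0 < y1 j2" "0 < y1 j3" "0 < y2 j3"
    and le: "(p1 * y1 j3) * (p2 * y2 j1) * (p3 * y3 j2) \<le> (q2 * y2 j3) * (q3 * y3 j1) * (q1 * y1 j2)"
  shows False
proof -
  define u1 u2 u3 where "u1 = p1 * y1 j3" and "u2 = p2 * y2 j1" and "u3 = p3 * y3 j2"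
  define v1 v2 v3 where "v1 = q2 * y2 j3" and "v2 = q3 * y3 j1" and "v3 = q1 * y1 j2"
  define w1 w2 w3 where "w1 = q1 * q2 * y1 j3 + p1 * p2 * y2 j3"
    and "w2 = q2 * q3 * y2 j1 + p2 * p3 * y3 j1" and "w3 = q3 * q1 * y3 j2 + p3 * p1 * y1 j2"
  have u: "0 < u1" "0 < u2" "0 < u3" and v: "0 < v1" "0 < v2" "0 < v3"
    and w: "0 \<le> w1" "0 \<le> w2" "0 \<le> w3"
    using pq_pos pos by (auto simp: u1_def u2_def u3_def v1_def v2_def v3_def w1_def w2_def w3_def)
  define s2 where "s2 = (\<lambda>s. next_param u1 v1 w1 s)"
  define s3 where "s3 = (\<lambda>s. next_param u2 v2 w2 (s2 s))"
  define s4 where "s4 = (\<lambda>s. next_param u3 v3 w3 (s3 s))"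
  have nn: "0 \<le> s2 s" "0 \<le> s3 s" "0 \<le> s4 s" if "0 \<le> s" for s
    using that u v w by (simp_all add: s2_def s3_def s4_def next_param(1))
  \<comment> \<open>\<open>M1 (s4 s)\<close> is where the chain of edges through the contact points, started at \<open>M1 s\<close>, returns to
    the first line; the triangles with first vertex \<open>M1 s\<close> and \<open>M1 (s4 s)\<close> are both nested.\<close>
  have s4_le: "s4 s \<le> s" if "0 \<le> s" for s
  proof -
    have "s4 s \<le> u3 / v3 * s3 s" unfolding s4_def by (rule next_param(2)) (use u v w nn that in auto)
    also have "\<dots> \<le> u3 / v3 * (u2 / v2 * s2 s)" unfolding s3_def
      by (intro mult_left_mono next_param(2)) (use u v w nn that in auto)
    also have "\<dots> \<le> u3 / v3 * (u2 / v2 * (u1 / v1 * s))" unfolding s2_def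
      by (intro mult_left_mono next_param(2)) (use u v w that in auto)
    also have "\<dots> = (u1 * u2 * u3) / (v1 * v2 * v3) * s" by (simp add: mult_ac)
    also have "\<dots> \<le> 1 * s"
      using le v that unfolding u1_def u2_def u3_def v1_def v2_def v3_def
      by (intro mult_right_mono) (simp_all add: divide_le_eq)
    finally show ?thesis by simp
  qed
  have tight: "E12 s (s2 s) j3 = 0" "E23 (s2 s) (s3 s) j1 = 0" "E31 (s3 s) (s4 s) j2 = 0" if "0 \<le> s" for s
    unfolding j s2_def s3_def s4_def
    by (rule edge_form_next_param;
        use u v w nn that in \<open>simp add: u1_def u2_def u3_def v1_def v2_def v3_def w1_def w2_def w3_def s2_def s3_def\<close>)+
  \<comment> \<open>Twice the parameter at which \<open>M1\<close> reaches the line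
    \<open>a i3\<close>.\<close>
  define T where "T = 2 * p3 / (q1 * q3)"
  have T: "0 \<le> T" using pq_pos by (simp add: T_def)
  have c2: "continuous_on {0..T} s2" unfolding s2_def
    by (rule continuous_on_next_param) (use v w in \<open>auto intro: continuous_intros\<close>)
  have c3: "continuous_on {0..T} s3" unfolding s3_def
    by (rule continuous_on_next_param) (use v w nn c2 in auto)
  have c4: "continuous_on {0..T} s4" unfolding s4_def
    by (rule continuous_on_next_param) (use v w nn c3 in auto)
  \<comment> \<open>The last family uses \<open>s4 s\<close> instead of \<open>s\<close>, because
    then the contact point \<open>b j2\<close> stays on its edge throughout.\<close>
  define G where "G = range (\<lambda>k s. a k \<bullet> M1 s) \<union> range (\<lambda>k s. a k \<bullet> M2 (s2 s)) \<union> range (\<lambda>k s. a k \<bullet> M3 (s3 s))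
    \<union> range (\<lambda>j s. E12 s (s2 s) j) \<union> range (\<lambda>j s. E23 (s2 s) (s3 s) j) \<union> range (\<lambda>j s. E31 (s3 s) (s4 s) j)"
  have fin: "finite G" by (simp add: G_def)
  have cont: "continuous_on {0..T} g" if "g \<in> G" for g
    using that unfolding G_def a_M edge_form_def
    by (elim UnE rangeE) (hypsubst, intro continuous_intros c2 c3 c4)+
  have s0: "s2 0 = 0" "s3 0 = 0" "s4 0 = 0" by (simp_all add: s2_def s3_def s4_def next_param_def)
  have start: "0 \<le> g 0" if "g \<in> G" for g
    using that unfolding G_def by (elim UnE rangeE) (simp_all add: s0 a_M edge_form_def am y)
  have exit: "a i3 \<bullet> M1 T < 0" using pq_pos by (simp add: ai_M T_def)
  have mem: "(\<lambda>s. a i3 \<bullet> M1 s) \<in> G" by (simp add: G_def)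
  obtain s g t where s: "s \<in> {0..T}" and G: "\<And>h. h \<in> G \<Longrightarrow> 0 \<le> h s"
    and g: "g \<in> G" "g s = 0" and t: "t \<in> {0..T}" "g t < 0"
    using first_exit[of G T "\<lambda>s. a i3 \<bullet> M1 s", OF fin _ _ mem exit T] cont start by blast
  have s_nn: "0 \<le> s" and t_nn: "0 \<le> t" using s t by auto
  have G': "0 \<le> a k \<bullet> M1 s" "0 \<le> a k \<bullet> M2 (s2 s)" "0 \<le> a k \<bullet> M3 (s3 s)"
    "0 \<le> E12 s (s2 s) j" "0 \<le> E23 (s2 s) (s3 s) j" "0 \<le> E31 (s3 s) (s4 s) j" for k j
    by (rule G; auto simp: G_def)+
  have interpolate: "0 \<le> c + r * d" if "0 \<le> c" "0 \<le> c + r' * d" "0 \<le> r" "r \<le> r'" for c d r r' :: real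
  proof (cases "0 \<le> d")
    case False
    then have "r' * d \<le> r * d" using that by (simp add: mult_right_mono_neg)
    then show ?thesis using that by linarith
  qed (use that in simp)
  have ad1: "admissible s (s2 s) (s3 s)"
  proof -
    have "0 \<le> E31 (s3 s) s j" for j
    proof -
      \<comment> \<open>The form is affine in its second parameter with nonnegative slope, so
        raising \<open>s4 s\<close> to \<open>s\<close> keeps it nonnegative.\<close>
      have "E31 (s3 s) s j = E31 (s3 s) (s4 s) j
        + (s - s4 s) * (s3 s * q3 * q1 * y3 j + (s3 s * p3 * p1 + q1) * y1 j + s3 s * q3 * p1 * y2 j)"
        by (simp add: edge_form_def algebra_simps)
      then show ?thesis using G'(6)[of j] s4_le[OF s_nn] nn[OF s_nn] pq_pos y[of j] by simp
    qed
    then show ?thesis using G' unfolding admissible_def by blast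
  qed
  have ad2: "admissible (s4 s) (s2 s) (s3 s)"
  proof -
    \<comment> \<open>This condition and the next are affine in the first parameter and hold at 0
      and at \<open>s\<close>, hence at \<open>s4 s\<close> in between.\<close>
    have "0 \<le> a k \<bullet> M1 (s4 s)" for k
      unfolding a_M by (rule interpolate[of _ s]) (use G'(1)[of k] am s4_le nn s_nn in \<open>simp_all add: a_M\<close>)
    moreover have "0 \<le> E12 (s4 s) (s2 s) j" for j
    proof -
      have e: "E12 r (s2 s) j = (s2 s * q2 * y2 j + y3 j)
          + r * ((s2 s * q1 * q2 - p1) * y1 j + s2 s * p1 * p2 * y2 j + s2 s * q1 * p2 * y3 j)" for r
        by (simp add: edge_form_def algebra_simps)
      show ?thesis unfolding e
        by (rule interpolate[of _ s]) (use G'(4)[of j] s4_le nn s_nn y[of j] pq_pos in \<open>simp_all add: e\<close>)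
    qed
    ultimately show ?thesis using G' unfolding admissible_def by blast
  qed
  have bnz: "b j1 \<noteq> 0" "b j2 \<noteq> 0" "b j3 \<noteq> 0"
    using pos coordinates_eq[of _ 0 0 0] by fastforce+
  note n1 = admissible_nested[OF ad1] and n2 = admissible_nested[OF ad2]
  note c1 = admissible_combination[OF ad1] and c2 = admissible_combination[OF ad2]
  \<comment> \<open>A member of \<open>G\<close> vanishing at \<open>s\<close> belongs to a multiple
    of a line or point already in contact, and therefore vanishes along the whole slide.\<close>
  have "g t = 0"
    using g(1) unfolding G_def
  proof (elim UnE rangeE)
    fix k assume gk: "g = (\<lambda>s. a k \<bullet> M1 s)"
    obtain c where "a k = c *\<^sub>R a i1"
      using vertex_parallel[OF n1 ai_M(1) _ anz(1)] g(2) unfolding gk by metis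
    then show ?thesis by (simp add: gk ai_M)
  next
    fix k assume gk: "g = (\<lambda>s. a k \<bullet> M2 (s2 s))"
    obtain c where "a k = c *\<^sub>R a i2"
      using vertex_parallel[OF nested_rotate[OF n1] ai_M(4) _ anz(2)] g(2) unfolding gk by metis
    then show ?thesis by (simp add: gk ai_M)
  next
    fix k assume gk: "g = (\<lambda>s. a k \<bullet> M3 (s3 s))"
    obtain c where "a k = c *\<^sub>R a i3"
      using vertex_parallel[OF nested_rotate[OF nested_rotate[OF n1]] ai_M(7) _ anz(3)] g(2) unfolding gk by metis
    then show ?thesis by (simp add: gk ai_M)
  next
    fix l assume gl: "g = (\<lambda>s. E12 s (s2 s) l)"
    obtain c where c: "b l = c *\<^sub>R b j3"
    proof (rule edge_parallel[OF n1 _ _ bnz(3)])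
      show "b j3 = (E23 (s2 s) (s3 s) j3 / slide_det s (s2 s) (s3 s)) *\<^sub>R M1 s + (E31 (s3 s) s j3 / slide_det s (s2 s) (s3 s)) *\<^sub>R M2 (s2 s)"
        using c1[of j3] tight(1)[OF s_nn] by simp
      show "b l = (E23 (s2 s) (s3 s) l / slide_det s (s2 s) (s3 s)) *\<^sub>R M1 s + (E31 (s3 s) s l / slide_det s (s2 s) (s3 s)) *\<^sub>R M2 (s2 s)"
        using c1[of l] g(2) by (simp add: gl)
    qed
    show ?thesis by (simp add: gl coordinates_parallel[OF c] edge_form_scale tight t_nn)
  next
    fix l assume gl: "g = (\<lambda>s. E23 (s2 s) (s3 s) l)"
    obtain c where c: "b l = c *\<^sub>R b j1"
    proof (rule edge_parallel[OF nested_rotate[OF n1] _ _ bnz(1)])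
      show "b j1 = (E31 (s3 s) s j1 / slide_det s (s2 s) (s3 s)) *\<^sub>R M2 (s2 s) + (E12 s (s2 s) j1 / slide_det s (s2 s) (s3 s)) *\<^sub>R M3 (s3 s)"
        using c1[of j1] tight(2)[OF s_nn] by simp
      show "b l = (E31 (s3 s) s l / slide_det s (s2 s) (s3 s)) *\<^sub>R M2 (s2 s) + (E12 s (s2 s) l / slide_det s (s2 s) (s3 s)) *\<^sub>R M3 (s3 s)"
        using c1[of l] g(2) by (simp add: gl)
    qed
    show ?thesis by (simp add: gl coordinates_parallel[OF c] edge_form_scale tight t_nn)
  next
    fix l assume gl: "g = (\<lambda>s. E31 (s3 s) (s4 s) l)"
    let ?D = "slide_det (s4 s) (s2 s) (s3 s)"
    obtain c where c: "b l = c *\<^sub>R b j2"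
    proof (rule edge_parallel[OF nested_swap[OF n2] _ _ bnz(2)])
      show "b j2 = (E23 (s2 s) (s3 s) j2 / ?D) *\<^sub>R M1 (s4 s) + (E12 (s4 s) (s2 s) j2 / ?D) *\<^sub>R M3 (s3 s)"
        using c2[of j2] tight(3)[OF s_nn] by simp
      show "b l = (E23 (s2 s) (s3 s) l / ?D) *\<^sub>R M1 (s4 s) + (E12 (s4 s) (s2 s) l / ?D) *\<^sub>R M3 (s3 s)"
        using c2[of l] g(2) by (simp add: gl)
    qed
    show ?thesis by (simp add: gl coordinates_parallel[OF c] edge_form_scale tight t_nn)
  qed
  with t(2) show False by simp
qed

text \<open>Mirroring exchanges each \<open>p\<close> with a \<open>q\<close> and reverses the
  inequality required for sliding, so one of the two directions is always possible.\<close>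

lemma touching_contradiction:
  assumes bnz: "b j1 \<noteq> 0" "b j2 \<noteq> 0" "b j3 \<noteq> 0" and j: "y1 j1 = 0" "y2 j2 = 0" "y3 j3 = 0"
  shows False
proof -
  interpret rot: frame a b m2 m3 m1 y2 y3 y1 i2 i3 i1 by (rule rotated)
  interpret rot2: frame a b m3 m1 m2 y3 y1 y2 i3 i1 i2 by (rule rot.rotated)
  interpret mir: frame a b m1 m3 m2 y1 y3 y2 i1 i3 i2 by (rule mirrored)
  have nz: "y2 j1 \<noteq> 0" "y3 j1 \<noteq> 0" "y3 j2 \<noteq> 0" "y1 j2 \<noteq> 0" "y1 j3 \<noteq> 0" "y2 j3 \<noteq> 0"
    using no_vertex_contact[of j2] no_vertex_contact[of j3] rot.no_vertex_contact[of j1]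
      rot.no_vertex_contact[of j3] rot2.no_vertex_contact[of j1] rot2.no_vertex_contact[of j2] bnz j by auto
  have pos: "0 < y2 j1" "0 < y3 j1" "0 < y3 j2" "0 < y1 j2" "0 < y1 j3" "0 < y2 j3"
    using nz y by (auto simp: order_less_le)
  have mir: "mir.p1 = q1" "mir.q1 = p1" "mir.p2 = q3" "mir.q2 = p3" "mir.p3 = q2" "mir.q3 = p2"
    by (simp_all add: pq_defs mir.pq_defs)
  show False
  proof (cases "(p1 * y1 j3) * (p2 * y2 j1) * (p3 * y3 j2) \<le> (q2 * y2 j3) * (q3 * y3 j1) * (q1 * y1 j2)")
    case True
    then show False by (rule slide_back_contradiction[OF j pos])
  next
    case False
    then have "(q1 * y1 j2) * (q3 * y3 j1) * (q2 * y2 j3) \<le> (p3 * y3 j2) * (p2 * y2 j1) * (p1 * y1 j3)"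
      by (simp add: mult_ac)
    then show False
      by (intro mir.slide_back_contradiction[OF j(1,3,2) pos(2,1,6,5,4,3)]) (simp only: mir)
  qed
qed

end

text \<open>The vertices are pushed to outer lines one after the other, each away from the next; a
  vertex on its line is not moved again. This gives a \<open>frame\<close>, which then slides to a
  touching one.\<close>

lemma (in free_pair) not_nested: "\<not> nested a b m1 m2 m3"
proof
  assume "nested a b m1 m2 m3"
  from push[OF this] obtain i1 t1 where 1: "nested a b (m1 - t1 *\<^sub>R m2) m2 m3"
    "a i1 \<bullet> (m1 - t1 *\<^sub>R m2) = 0" "0 < a i1 \<bullet> m2" by blast
  define n1 where "n1 = m1 - t1 *\<^sub>R m2"
  from push[OF nested_rotate[OF 1(1)]] obtain i2 t2 where 2: "nested a b (m2 - t2 *\<^sub>R m3) m3 n1"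
    "a i2 \<bullet> (m2 - t2 *\<^sub>R m3) = 0" "0 < a i2 \<bullet> m3" unfolding n1_def by blast
  define n2 where "n2 = m2 - t2 *\<^sub>R m3"
  from push[OF nested_rotate[OF 2(1)]] obtain i3 t3 where 3: "nested a b (m3 - t3 *\<^sub>R n1) n1 n2"
    "a i3 \<bullet> (m3 - t3 *\<^sub>R n1) = 0" "0 < a i3 \<bullet> n1" unfolding n2_def by blast
  define n3 where "n3 = m3 - t3 *\<^sub>R n1"
  have n: "nested a b n1 n2 n3" using nested_rotate[OF 3(1)] by (simp add: n3_def)
  then have "\<forall>j. \<exists>x y z. 0 \<le> x \<and> 0 \<le> y \<and> 0 \<le> z \<and> b j = x *\<^sub>R n1 + y *\<^sub>R n2 + z *\<^sub>R n3"
    by (simp add: nested_def)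
  then obtain y1 y2 y3 where "\<And>j. 0 \<le> y1 j" "\<And>j. 0 \<le> y2 j" "\<And>j. 0 \<le> y3 j"
    "\<And>j. b j = y1 j *\<^sub>R n1 + y2 j *\<^sub>R n2 + y3 j *\<^sub>R n3" by metis
  then interpret frame a b n1 n2 n3 y1 y2 y3 i1 i2 i3
    using n 1 2 3 by unfold_locales (auto simp: nested_def n1_def n2_def n3_def)
  obtain n1 n2 n3 z1 z2 z3 j1 j2 j3 where "frame a b n1 n2 n3 z1 z2 z3 i1 i2 i3"
    "b j1 \<noteq> 0" "b j2 \<noteq> 0" "b j3 \<noteq> 0" "z1 j1 = 0" "z2 j2 = 0" "z3 j3 = 0"
    by (rule touching_frame)
  then show False by (rule frame.touching_contradiction)
qed

lemma nested_imp_vertex_condition: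
  fixes a :: "'m::finite \<Rightarrow> real^3" and b :: "'n::finite \<Rightarrow> real^3"
  assumes n: "nested a b m1 m2 m3" and s: "spans a" "spans b"
  shows "vertex_condition a b \<or> vertex_condition b a"
proof (rule ccontr)
  assume no: "\<not> ?thesis"
  have "vertex_free a b" unfolding vertex_free_def
    using no vertex_imp_vertex_condition[of a b _ _ _ _ _, OF _ s(2)] by blast
  moreover have "edge_free a b" unfolding edge_free_def
  proof (intro allI impI)
    fix m1 m2 m3 i j x y x' y'
    assume "nested a b m1 m2 m3" "b i = x *\<^sub>R m1 + y *\<^sub>R m2" "b j = x' *\<^sub>R m1 + y' *\<^sub>R m2"
    from edge_imp_vertex_condition[OF this(1) s this(2,3)] show "b i \<times> b j = 0" using no by blast
  qed
  ultimately have "free_pair a b" using s by (simp add: free_pair_def)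
  then show False using free_pair.not_nested n by blast
qed

section \<open>Construction of a nested cone from the vertex condition\<close>

lemma F_det_scale: "F_det (c *\<^sub>R v) b b' x y z = c\<^sup>2 * F_det v b b' x y z"
  by (simp add: F_det_def cross_mult_left det3_scaleR power2_eq_square)

text \<open>Both points lie on the line \<open>l\<close>, so their cross product is a multiple of
  \<open>l\<close>. This is the case of coinciding tangents.\<close>

lemma det3_cross_cross: "det3 (l \<times> x) (l \<times> y) z = (l \<bullet> (x \<times> y)) * (l \<bullet> z)"
proof -
  have "(l \<times> x) \<times> (l \<times> y) = (l \<bullet> (x \<times> y)) *\<^sub>R l"
    by (simp add: cross_cross_det dot_cross_det[symmetric] dot_cross_self)
  then show ?thesis by (metis det3_eq_dot_cross det3_rotate(2) inner_commute inner_scaleR_left)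
qed

text \<open>The triangle has the vertex \<open>m\<close> and two more, obtained by moving
  \<open>b I\<close> and \<open>b J\<close> along the tangents away from \<open>m\<close> to the
  boundary of the outer polygon. The assumption on \<open>F_det\<close> makes the coordinates at
  \<open>m\<close> nonnegative.\<close>

lemma tangents_imp_nested:
  fixes a :: "'m::finite \<Rightarrow> real^3" and b :: "'n \<Rightarrow> real^3"
  assumes sa: "spans a" and nn: "\<And>k j. 0 \<le> a k \<bullet> b j" and m: "\<And>k. 0 \<le> a k \<bullet> m"
    and D: "det3 m (b I) (b J) \<noteq> 0"
    and tangent: "\<And>z. 0 \<le> det3 m (b I) (b J) * det3 m (b z) (b J)"
      "\<And>z. 0 \<le> det3 m (b I) (b J) * det3 m (b I) (b z)"
    and F: "\<And>k l z. 0 < a k \<bullet> m \<Longrightarrow> 0 < a l \<bullet> m \<Longrightarrow> z \<noteq> I \<Longrightarrow> z \<noteq> J \<Longrightarrow>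
      0 \<le> F_det m (b I) (b J) (a k) (a l) (b z) * F_det m (b I) (b J) (a l) (a k) (b z)"
  shows "\<exists>m1 m2 m3. nested a b m1 m2 m3"
proof -
  let ?D = "det3 m (b I) (b J)"
  define x y z where "x = (\<lambda>j. det3 (b j) (b I) (b J) / ?D)" and "y = (\<lambda>j. det3 m (b j) (b J) / ?D)"
    and "z = (\<lambda>j. det3 m (b I) (b j) / ?D)"
  have b: "b j = x j *\<^sub>R m + y j *\<^sub>R b I + z j *\<^sub>R b J" for j
  proof -
    have "b j = (1 / ?D) *\<^sub>R (?D *\<^sub>R b j)" using D by simp
    then show ?thesis unfolding det3_cramer[of m "b I" "b J" "b j"]
      by (simp add: x_def y_def z_def scaleR_right_distrib)
  qed
  have yz: "0 \<le> y j" "0 \<le> z j" for j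
    using tangent[of j] D by (auto simp: y_def z_def zero_le_divide_iff zero_le_mult_iff)
  \<comment> \<open>If \<open>a k\<close> misses \<open>m\<close>, then
    \<open>b I - s k *\<^sub>R m\<close> and \<open>b J - t k *\<^sub>R m\<close> lie on it; the
    smallest values belong to the lines met first.\<close>
  define s t where "s = (\<lambda>k. (a k \<bullet> b I) / (a k \<bullet> m))" and "t = (\<lambda>k. (a k \<bullet> b J) / (a k \<bullet> m))"
  have st: "0 \<le> s k" "0 \<le> t k" for k using nn m by (simp_all add: s_def t_def)
  let ?K = "{k. 0 < a k \<bullet> m}"
  have "m \<noteq> 0" using D by (auto simp: det3_eq_dot_cross)
  then obtain k where "a k \<bullet> m \<noteq> 0" using sa by (auto dest: spansD)
  then have K: "finite ?K" "?K \<noteq> {}" using m by (auto simp: order_less_le)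
  obtain k where k: "k \<in> ?K" "\<And>i. i \<in> ?K \<Longrightarrow> s k \<le> s i"
    using ex_is_arg_min_if_finite[OF K, of s] unfolding is_arg_min_linorder by blast
  obtain l where l: "l \<in> ?K" "\<And>i. i \<in> ?K \<Longrightarrow> t l \<le> t i"
    using ex_is_arg_min_if_finite[OF K, of t] unfolding is_arg_min_linorder by blast
  have in_cone: "0 \<le> a i \<bullet> (b I - s k *\<^sub>R m)" "0 \<le> a i \<bullet> (b J - t l *\<^sub>R m)" for i
  proof -
    have "s k * (a i \<bullet> m) \<le> a i \<bullet> b I \<and> t l * (a i \<bullet> m) \<le> a i \<bullet> b J"
    proof (cases "i \<in> ?K")
      case True
      then show ?thesis using k(2)[of i] l(2)[of i] by (simp add: s_def[abs_def] t_def[abs_def] le_divide_eq)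
    next
      case False
      then have "a i \<bullet> m = 0" using m[of i] by simp
      then show ?thesis using nn by simp
    qed
    then show "0 \<le> a i \<bullet> (b I - s k *\<^sub>R m)" "0 \<le> a i \<bullet> (b J - t l *\<^sub>R m)"
      by (simp_all add: inner_diff_right)
  qed
  \<comment> \<open>The coordinate of \<open>b j\<close> at \<open>m\<close> when the other two
    generators are \<open>b I - s p *\<^sub>R m\<close> and
    \<open>b J - t q *\<^sub>R m\<close>.\<close>
  define X where "X = (\<lambda>p q j. x j + s p * y j + t q * z j)"
  have F_eq: "F_det m (b I) (b J) (a p) (a q) (b j) = ?D * ((a p \<bullet> m) * (a q \<bullet> m) * X p q j)"
    if "p \<in> ?K" "q \<in> ?K" for p q j
    using F_det_coordinates[of "b I" 0 m 1 "b I" 0 "b J" "b J" 0 0 1 "b j" "x j" "y j" "z j" 1 "a p" "a q"] b[of j] that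
    by (simp add: X_def s_def t_def inner_commute[of m] inner_commute[of "b _"] field_simps)
  have diag: "0 \<le> X p p j" if "p \<in> ?K" for p j
  proof -
    have "a p \<bullet> b j = (a p \<bullet> m) * X p p j"
      using that by (subst b) (simp add: X_def s_def t_def inner_add_right field_simps)
    then show ?thesis using nn[of p j] that by (simp add: zero_le_mult_iff)
  qed
  \<comment> \<open>\<open>X k l + X l k = X k k + X l l \<ge> 0\<close>, so a nonnegative product forces both to be nonnegative.\<close>
  have "0 \<le> X k l j" for j
  proof (cases "j = I \<or> j = J")
    case True
    have "x I = 0" "x J = 0" by (simp_all add: x_def)
    then show ?thesis using True yz[of j] st by (auto simp: X_def)
  next
    case False
    let ?w = "(a k \<bullet> m) * (a l \<bullet> m)"
    have "0 \<le> (?D * (?w * X k l j)) * (?D * (?w * X l k j))"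
      using F[of k l j] False k(1) l(1) by (simp add: F_eq mult.commute)
    also have "\<dots> = (?D * ?w)\<^sup>2 * (X k l j * X l k j)" by (simp add: power2_eq_square)
    finally have "0 \<le> X k l j * X l k j"
      using D k(1) l(1) by (simp add: zero_le_mult_iff)
    moreover have "X k l j + X l k j = X k k j + X l l j" by (simp add: X_def)
    ultimately show ?thesis using diag[OF k(1)] diag[OF l(1)]
      by (smt (verit) mult_pos_neg mult_neg_pos zero_le_mult_iff)
  qed
  moreover have "b j = X k l j *\<^sub>R m + y j *\<^sub>R (b I - s k *\<^sub>R m) + z j *\<^sub>R (b J - t l *\<^sub>R m)" for j
    by (subst b) (simp add: X_def algebra_simps)
  ultimately have "nested a b m (b I - s k *\<^sub>R m) (b J - t l *\<^sub>R m)"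
    unfolding nested_def using m in_cone yz by blast
  then show ?thesis by blast
qed

text \<open>The pair \<open>(u, v)\<close> is parallel to the nonzero extreme direction
  \<open>(x, y)\<close> and inherits its inequality against \<open>(x', y')\<close>.\<close>

lemma direction_le:
  fixes u v x y x' y' :: real
  assumes "u * y = v * x" "x' * y \<le> x * y'" "x \<noteq> 0 \<or> y \<noteq> 0" "0 \<le> x" "0 \<le> y" "0 \<le> u" "0 \<le> v"
  shows "v * x' \<le> u * y'"
proof (cases "x = 0")
  case True
  then have "0 < y" using assms by simp
  have "y * (v * x') \<le> v * (x * y')"
    using mult_left_mono[OF assms(2) \<open>0 \<le> v\<close>] by (simp add: mult_ac)
  also have "\<dots> = y * (u * y')" using assms(1) by (metis mult.assoc mult.commute)
  finally show ?thesis using \<open>0 < y\<close> by simp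
next
  case False
  then have "0 < x" using assms by simp
  have "x * (v * x') = u * (x' * y)" using assms(1) by (metis mult.assoc mult.commute)
  also have "\<dots> \<le> x * (u * y')"
    using mult_left_mono[OF assms(2) \<open>0 \<le> u\<close>] by (simp add: mult_ac)
  finally show ?thesis using \<open>0 < x\<close> by simp
qed

text \<open>Up to sign, \<open>a i \<times> a j\<close> is a vertex of the triangle. If the tangents
  through \<open>b i'\<close> and \<open>b j'\<close> differ, \<open>tangents_imp_nested\<close>
  applies directly; otherwise the second tangent is chosen anew.\<close>

lemma vertex_condition_imp_nested:
  fixes a :: "'m::finite \<Rightarrow> real^3" and b :: "'n::finite \<Rightarrow> real^3"
  assumes vc: "vertex_condition a b" and sa: "spans a" and sb: "spans b" and nn: "\<And>k j. 0 \<le> a k \<bullet> b j"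
  shows "\<exists>m1 m2 m3. nested a b m1 m2 m3"
proof -
  obtain i j i' j' where v: "a i \<times> a j \<noteq> 0" "(a i \<times> a j) \<times> b i' \<noteq> 0" "(a i \<times> a j) \<times> b j' \<noteq> 0"
    and s1: "same_sign_or_zero (\<lambda>k. det3 (a i) (a j) (a k)) (UNIV - {i, j})"
    and s2: "same_sign_or_zero (\<lambda>k'. det3 (a i \<times> a j) (b i') (b k')) (UNIV - {i'})"
    and s3: "same_sign_or_zero (\<lambda>k'. det3 (a i \<times> a j) (b j') (b k')) (UNIV - {j'})"
    and F: "\<And>k l k'. {k, l} \<subseteq> UNIV - {i, j} \<Longrightarrow> k' \<in> UNIV - {i', j'} \<Longrightarrow>
        0 \<le> F_det (a i \<times> a j) (b i') (b j') (a k) (a l) (b k')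
            * F_det (a i \<times> a j) (b i') (b j') (a l) (a k) (b k')"
    using vc unfolding vertex_condition_def by blast
  define v where "v = a i \<times> a j"
  have av: "a i \<bullet> v = 0" "a j \<bullet> v = 0" by (simp_all add: v_def dot_cross_self)
  have e: "det3 (a i) (a j) x = x \<bullet> v" for x unfolding v_def by (metis det3_eq_dot_cross det3_rotate(2))
  have "(\<forall>k. 0 \<le> a k \<bullet> v) \<or> (\<forall>k. a k \<bullet> v \<le> 0)"
    using s1 av unfolding same_sign_or_zero_def e by (metis DiffI UNIV_I insertE order_refl singletonD)
  then obtain c :: real where c: "c\<^sup>2 = 1" and m: "\<And>k. 0 \<le> a k \<bullet> (c *\<^sub>R v)"
  proof
    assume "\<forall>k. 0 \<le> a k \<bullet> v" then show thesis by (intro that[of 1]) auto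
  next
    assume "\<forall>k. a k \<bullet> v \<le> 0" then show thesis by (intro that[of "-1"]) auto
  qed
  define m where "m = c *\<^sub>R v"
  have m_pos: "0 \<le> a k \<bullet> m" for k using m by (simp add: m_def)
  have am: "a i \<bullet> m = 0" "a j \<bullet> m = 0" using av by (simp_all add: m_def)
  have c0: "c \<noteq> 0" using c by auto
  have Fm: "F_det m b1 b2 x y z = F_det v b1 b2 x y z" for b1 b2 x y z
    by (simp add: m_def F_det_scale c)
  \<comment> \<open>Independently of the sign of \<open>v\<close>, all \<open>b q\<close> lie on one
    side of the line through \<open>v\<close> and \<open>b p\<close>.\<close>
  define one_sided where "one_sided = (\<lambda>p. \<forall>q r. 0 \<le> det3 v (b p) (b q) * det3 v (b p) (b r))"
  have os: "one_sided p" if "same_sign_or_zero (\<lambda>q. det3 v (b p) (b q)) (UNIV - {p})" for p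
  proof -
    have "(\<forall>q. 0 \<le> det3 v (b p) (b q)) \<or> (\<forall>q. det3 v (b p) (b q) \<le> 0)"
      using that unfolding same_sign_or_zero_def by (metis DiffI UNIV_I det3_repeated(3) order_refl singletonD)
    then show ?thesis unfolding one_sided_def by (auto intro: mult_nonneg_nonneg mult_nonpos_nonpos)
  qed
  have os_i': "one_sided i'" and os_j': "one_sided j'" using s2 s3 os by (auto simp: v_def)
  have det_m: "det3 m x y = c * det3 v x y" for x y by (simp add: m_def det3_scaleR)
  have finish: ?thesis
    if D: "det3 v (b i') (b J) \<noteq> 0" and J: "one_sided J"
      and F: "\<And>k l z. 0 < a k \<bullet> m \<Longrightarrow> 0 < a l \<bullet> m \<Longrightarrow> z \<noteq> i' \<Longrightarrow> z \<noteq> J \<Longrightarrow>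
        0 \<le> F_det m (b i') (b J) (a k) (a l) (b z) * F_det m (b i') (b J) (a l) (a k) (b z)" for J
  proof (rule tangents_imp_nested[OF sa nn m_pos _ _ _ F])
    show "det3 m (b i') (b J) \<noteq> 0" using D c0 by (simp add: det_m)
    fix z
    have "det3 m (b i') (b J) * det3 m (b i') (b z) = c\<^sup>2 * (det3 v (b i') (b J) * det3 v (b i') (b z))"
      by (simp add: det_m power2_eq_square)
    then show "0 \<le> det3 m (b i') (b J) * det3 m (b i') (b z)"
      using os_i' by (simp add: c one_sided_def)
    have "det3 m (b i') (b J) * det3 m (b z) (b J) = c\<^sup>2 * (det3 v (b J) (b i') * det3 v (b J) (b z))"
      by (simp add: det_m power2_eq_square det3_swap(2)[of v _ "b J"])
    then show "0 \<le> det3 m (b i') (b J) * det3 m (b z) (b J)"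
      using J by (simp add: c one_sided_def)
  qed
  have not_ij: "{k, l} \<subseteq> UNIV - {i, j}" if "0 < a k \<bullet> m" "0 < a l \<bullet> m" for k l
    using that am by auto
  show ?thesis
  proof (cases "det3 v (b i') (b j') = 0")
    case False
    then show ?thesis
      using F[OF not_ij] by (intro finish[OF _ os_j']) (auto simp: Fm v_def)
  next
    case D: True
    \<comment> \<open>Here \<open>b i'\<close> and \<open>b j'\<close> span the same tangent through \<open>v\<close>, and (iv) makes all the lines \<open>a k\<close>
      not through \<open>v\<close> meet this tangent in the same point; replace \<open>b j'\<close> by a point on the
      other tangent.\<close>
    define L where "L = v \<times> b i'"
    have L: "L \<noteq> 0" using v by (simp add: L_def v_def)
    have det_L: "det3 v (b i') x = L \<bullet> x" for x 
      by (subst det3_rotate(2)) (simp add: det3_eq_dot_cross L_def inner_commute)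
    obtain d where d: "v \<times> b j' = d *\<^sub>R L"
    proof (rule parallelE[OF _ L])
      show "L \<times> (v \<times> b j') = 0"
        using D unfolding L_def by (simp add: cross_cross_det flip: det3_def)
    qed
    then have "d \<noteq> 0" using v by (auto simp: v_def)
    \<comment> \<open>This is antisymmetric in \<open>x\<close> and \<open>y\<close>, so (iv) says
      that minus a square is nonnegative.\<close>
    have F_L: "F_det v (b i') (b j') x y z = d * ((L \<bullet> (x \<times> y)) * (L \<bullet> z))" for x y z
      unfolding F_det_def d L_def[symmetric] by (simp add: det3_cross_cross cross_mult_left det3_scaleR)
    obtain z where z: "L \<bullet> b z \<noteq> 0" using spansD[OF sb L] by (auto simp: inner_commute)
    have "L \<bullet> b i' = 0" "L \<bullet> b j' = 0" using D det_L[of "b i'"] det_L[of "b j'"] by auto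
    then have z': "z \<in> UNIV - {i', j'}" using z by auto
    have concurrent: "(m \<bullet> a k) * (b i' \<bullet> a l) = (m \<bullet> a l) * (b i' \<bullet> a k)" if kl: "0 < a k \<bullet> m" "0 < a l \<bullet> m" for k l
    proof -
      have "0 \<le> F_det v (b i') (b j') (a k) (a l) (b z) * F_det v (b i') (b j') (a l) (a k) (b z)"
        using F[OF not_ij[OF kl] z'] by (simp add: v_def)
      also have "\<dots> = - ((d * (L \<bullet> b z))\<^sup>2 * (L \<bullet> (a k \<times> a l))\<^sup>2)"
        unfolding F_L cross_skew[of "a l" "a k"] by (simp add: power2_eq_square)
      finally have "(d * (L \<bullet> b z))\<^sup>2 * (L \<bullet> (a k \<times> a l))\<^sup>2 \<le> 0" by simp
      moreover have "0 < (d * (L \<bullet> b z))\<^sup>2" using \<open>d \<noteq> 0\<close> z by simp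
      ultimately have "L \<bullet> (a k \<times> a l) = 0" by (simp add: mult_le_0_iff)
      then show ?thesis by (simp add: L_def dot_cross m_def algebra_simps)
    qed
    \<comment> \<open>The pair \<open>(x z, y z)\<close> is the direction in which
      \<open>b z\<close> is seen from \<open>v\<close>; it lies in the quadrant by
      \<open>nn\<close>.\<close>
    define x y where "x = (\<lambda>z. a i \<bullet> b z)" and "y = (\<lambda>z. a j \<bullet> b z)"
    have xy: "0 \<le> x z" "0 \<le> y z" for z using nn by (simp_all add: x_def y_def)
    have det_xy: "det3 v (b p) (b q) = x p * y q - y p * x q" for p q
      by (simp add: det3_eq_dot_cross v_def dot_cross x_def y_def)
    obtain J where J: "one_sided J" "det3 v (b i') (b J) \<noteq> 0"
    proof -
      have "x z \<noteq> 0 \<or> y z \<noteq> 0" using z det_xy[of i' z] by (auto simp: det_L)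
      then have nz: "\<exists>z. x z \<noteq> 0 \<or> y z \<noteq> 0" "\<exists>z. y z \<noteq> 0 \<or> x z \<noteq> 0" by blast+
      obtain p where p: "x p \<noteq> 0 \<or> y p \<noteq> 0" "\<And>q. x q * y p \<le> x p * y q"
        using extremal_direction[OF xy nz(1)] by blast
      obtain q where q: "y q \<noteq> 0 \<or> x q \<noteq> 0" "\<And>r. y r * x q \<le> y q * x r"
        using extremal_direction[OF xy(2,1) nz(2)] by blast
      have "one_sided p" "one_sided q" unfolding one_sided_def det_xy
        using p(2) q(2) by (auto intro!: mult_nonneg_nonneg mult_nonpos_nonpos simp: mult.commute)
      \<comment> \<open>If both extreme directions were on the tangent through \<open>b i'\<close>,
        all inner points would be, against the choice of \<open>z\<close>.\<close>
      moreover have "det3 v (b i') (b p) \<noteq> 0 \<or> det3 v (b i') (b q) \<noteq> 0"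
      proof (rule ccontr)
        assume "\<not> ?thesis"
        then have e: "x i' * y p = y i' * x p" "y i' * x q = x i' * y q" by (simp_all add: det_xy)
        have "y i' * x z \<le> x i' * y z" by (rule direction_le[OF e(1) p(2)[of z] p(1)]) (rule xy)+
        moreover have "x i' * y z \<le> y i' * x z" by (rule direction_le[OF e(2) q(2)[of z] q(1)]) (rule xy)+
        ultimately show False using z det_xy[of i' z] by (simp add: det_L)
      qed
      ultimately show thesis using that by blast
    qed
    show ?thesis
    proof (rule finish[OF J(2,1)])
      fix k l r assume kl: "0 < a k \<bullet> m" "0 < a l \<bullet> m"
      let ?D = "det3 m (b i') (b J)"
      have D0: "?D \<noteq> 0" using J(2) c0 by (simp add: det_m)
      define x y z where "x = det3 (b r) (b i') (b J) / ?D" and "y = det3 m (b r) (b J) / ?D"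
        and "z = det3 m (b i') (b r) / ?D"
      have b: "b r = x *\<^sub>R m + y *\<^sub>R b i' + z *\<^sub>R b J"
      proof -
        have "b r = (1 / ?D) *\<^sub>R (?D *\<^sub>R b r)" using D0 by simp
        then show ?thesis unfolding det3_cramer[of m "b i'" "b J" "b r"]
          by (simp add: x_def y_def z_def scaleR_right_distrib)
      qed
      \<comment> \<open>Concurrency splits the value into a factor for \<open>a p\<close> and one
        for \<open>a q\<close>, whose signs are known.\<close>
      have F': "F_det m (b i') (b J) (a p) (a q) (b r) = ?D * (m \<bullet> a p) * (a q \<bullet> b r)"
        if "0 < a p \<bullet> m" "0 < a q \<bullet> m" for p q
      proof -
        have "F_det m (b i') (b J) (a p) (a q) (b r)
          = ?D * ((b i' \<bullet> a p) * (m \<bullet> a q) * y + (m \<bullet> a p) * (b J \<bullet> a q) * z + (m \<bullet> a p) * (m \<bullet> a q) * x)"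
          using F_det_coordinates[of "b i'" 0 m 1 "b i'" 0 "b J" "b J" 0 0 1 "b r" x y z 1 "a p" "a q"] b by simp
        also have "(b i' \<bullet> a p) * (m \<bullet> a q) = (m \<bullet> a p) * (b i' \<bullet> a q)"
          using concurrent[OF that] by simp
        also have "?D * ((m \<bullet> a p) * (b i' \<bullet> a q) * y + (m \<bullet> a p) * (b J \<bullet> a q) * z + (m \<bullet> a p) * (m \<bullet> a q) * x)
          = ?D * (m \<bullet> a p) * (a q \<bullet> (x *\<^sub>R m + y *\<^sub>R b i' + z *\<^sub>R b J))"
          by (simp add: inner_add_right inner_commute[of _ "a q"] algebra_simps)
        finally show ?thesis unfolding b[symmetric] .
      qed
      have "F_det m (b i') (b J) (a k) (a l) (b r) * F_det m (b i') (b J) (a l) (a k) (b r)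
        = ?D\<^sup>2 * ((a k \<bullet> m) * (a l \<bullet> m) * ((a l \<bullet> b r) * (a k \<bullet> b r)))"
        unfolding F'[OF kl] F'[OF kl(2,1)] by (simp add: power2_eq_square inner_commute[of m])
      also have "0 \<le> \<dots>" using kl nn by simp
      finally show "0 \<le> F_det m (b i') (b J) (a k) (a l) (b r) * F_det m (b i') (b J) (a l) (a k) (b r)" .
    qed
  qed
qed

section \<open>Nonnegative factorizations\<close>

lemma affine_dependent_of_dim_le_2:
  fixes \<phi> :: "'a::euclidean_space \<Rightarrow> real"
  assumes lin: "linear \<phi>" and one: "\<phi> x = 1" "\<phi> y = 1" "\<phi> z = 1"
    and sub: "x \<in> V" "y \<in> V" "z \<in> V" and dim: "dim V < 3"
  shows "collinear {x, y, z}"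
proof (cases "x = y \<or> x = z \<or> y = z")
  case True
  then show ?thesis by (auto simp: insert_commute)
next
  case False
  let ?S = "{x, y, z}"
  have "card ?S = 3" using False by simp
  then have "dependent ?S"
    using independent_card_le_dim[of ?S V] sub dim by auto
  then obtain u where u: "\<exists>v\<in>?S. u v \<noteq> 0" "(\<Sum>v\<in>?S. u v *\<^sub>R v) = 0"
    using real_vector.dependent_finite[of ?S] by auto
  \<comment> \<open>Since \<open>\<phi>\<close> is 1 on the three vectors, the coefficients of a
    linear dependence sum to 0, so it is an affine dependence.\<close>
  have "sum u ?S = \<phi> (\<Sum>v\<in>?S. u v *\<^sub>R v)"
    unfolding linear_sum[OF lin] using one by (intro sum.cong) (auto simp: linear_scale[OF lin])
  also have "\<dots> = 0" by (simp add: u(2) linear_0[OF lin])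
  finally have "affine_dependent ?S" using u by (subst affine_dependent_explicit_finite) auto
  then show ?thesis by (simp add: collinear_3_eq_affine_dependent)
qed

text \<open>Two points at maximal distance are the ends: any other order on the line would give a
  larger distance.\<close>

lemma finite_collinear_extremes:
  fixes S :: "'a::euclidean_space set"
  assumes "finite S" "S \<noteq> {}" and col: "\<And>x y z. x \<in> S \<Longrightarrow> y \<in> S \<Longrightarrow> z \<in> S \<Longrightarrow> collinear {x, y, z}"
  obtains x y where "x \<in> S" "y \<in> S" "S \<subseteq> closed_segment x y"
proof -
  let ?P = "Sigma S (\<lambda>_. S)"
  have "finite ?P" "?P \<noteq> {}" using assms by auto
  then obtain p where p: "p \<in> ?P" "\<And>q. q \<in> ?P \<Longrightarrow> - dist (fst p) (snd p) \<le> - dist (fst q) (snd q)"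
    using ex_is_arg_min_if_finite[of ?P "\<lambda>p. - dist (fst p) (snd p)"]
    unfolding is_arg_min_linorder by blast
  obtain x y where [simp]: "p = (x, y)" by (cases p)
  have xy: "x \<in> S" "y \<in> S" using p(1) by auto
  have max: "dist u v \<le> dist x y" if "u \<in> S" "v \<in> S" for u v using p(2)[of "(u, v)"] that by simp
  have "z \<in> closed_segment x y" if "z \<in> S" for z
  proof -
    have "between (y, z) x \<or> between (z, x) y \<or> between (x, y) z"
      using col[OF xy that] by (simp add: collinear_between_cases)
    then show ?thesis
    proof (elim disjE)
      assume "between (y, z) x"
      then have "x = z" using max[OF xy(2) that] by (simp add: between dist_commute)
      then show ?thesis by simp
    next
      assume "between (z, x) y"
      then have "y = z" using max[OF that xy(1)] by (simp add: between dist_commute)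
      then show ?thesis by simp
    qed (simp add: between_mem_segment)
  qed
  with that xy show thesis by blast
qed

lemma nonneg_rank_le_3I:
  fixes P :: "real^'n^'m"
  assumes "\<And>k. 0 \<le> u1 $ k \<and> 0 \<le> u2 $ k \<and> 0 \<le> u3 $ k"
    and "\<And>j. \<exists>x y z. 0 \<le> x \<and> 0 \<le> y \<and> 0 \<le> z \<and> column j P = x *\<^sub>R u1 + y *\<^sub>R u2 + z *\<^sub>R u3"
  shows "nonneg_rank_le_3 P"
proof -
  obtain x y z where xyz: "\<And>j. 0 \<le> x j" "\<And>j. 0 \<le> y j" "\<And>j. 0 \<le> z j"
    and c: "\<And>j. column j P = x j *\<^sub>R u1 + y j *\<^sub>R u2 + z j *\<^sub>R u3"
    using assms(2) by metis
  let ?A = "\<chi> k. vector [u1 $ k, u2 $ k, u3 $ k] :: real^3^'m"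
  let ?B = "vector [\<chi> j. x j, \<chi> j. y j, \<chi> j. z j] :: real^'n^3"
  have "P $ k $ j = (?A ** ?B) $ k $ j" for k j
  proof -
    have "P $ k $ j = column j P $ k" by (simp add: column_def)
    then show ?thesis by (simp add: c matrix_matrix_mult_def sum_3 mult.commute)
  qed
  then have "P = ?A ** ?B" by (simp add: vec_eq_iff)
  moreover have "nonneg_matrix ?A" "nonneg_matrix ?B"
    using assms(1) xyz by (auto simp: nonneg_matrix_def forall_3)
  ultimately show ?thesis unfolding nonneg_rank_le_3_def by blast
qed

text \<open>Scaled to coordinate sum 1, the nonzero columns lie on one line, and the two extreme
  ones generate all columns; the third generator is 0.\<close>

lemma nonneg_rank_of_rank_less_3:
  fixes P :: "real^'n^'m"
  assumes nn: "nonneg_matrix P" and rk: "rank P < 3"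
  shows "nonneg_rank_le_3 P"
proof (cases "P = 0")
  case True
  then show ?thesis
    by (intro nonneg_rank_le_3I[of 0 0 0]) (auto simp: column_def vec_eq_iff)
next
  case False
  define \<phi> :: "real^'m \<Rightarrow> real" where "\<phi> = (\<lambda>v. \<Sum>k\<in>UNIV. v $ k)"
  have lin: "linear \<phi>"
    by (rule linearI) (simp_all add: \<phi>_def sum.distrib sum_distrib_left)
  have c_nn: "0 \<le> column j P $ k" for j k using nn by (simp add: nonneg_matrix_def column_def)
  have \<phi>_nn: "0 \<le> \<phi> (column j P)" for j by (simp add: \<phi>_def sum_nonneg c_nn)
  have \<phi>_0: "column j P = 0" if "\<phi> (column j P) = 0" for j
    using that c_nn by (simp add: \<phi>_def sum_nonneg_eq_0_iff vec_eq_iff)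
  define S where "S = {(1 / \<phi> (column j P)) *\<^sub>R column j P | j. \<phi> (column j P) \<noteq> 0}"
  have S1: "\<phi> v = 1" if "v \<in> S" for v using that by (auto simp: S_def linear_scale[OF lin])
  have S_nn: "0 \<le> v $ k" if "v \<in> S" for v k using that c_nn \<phi>_nn by (auto simp: S_def)
  have Ssub: "S \<subseteq> span (columns P)"
    by (auto simp: S_def columns_def intro: span_scale span_base)
  have "finite S"
    by (rule finite_subset[of _ "range (\<lambda>j. (1 / \<phi> (column j P)) *\<^sub>R column j P)"]) (auto simp: S_def)
  moreover have "S \<noteq> {}"
  proof
    assume "S = {}"
    then have "column j P = 0" for j using \<phi>_0 by (auto simp: S_def)
    then show False using False by (simp add: column_def vec_eq_iff)
  qed
  moreover have "collinear {x, y, z}" if "x \<in> S" "y \<in> S" "z \<in> S" for x y z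
    using that S1 Ssub rk
    by (intro affine_dependent_of_dim_le_2[OF lin, of _ _ _ "span (columns P)"]) (auto simp: column_rank_def)
  ultimately obtain x y where xy: "x \<in> S" "y \<in> S" "S \<subseteq> closed_segment x y"
    using finite_collinear_extremes by blast
  show ?thesis
  proof (rule nonneg_rank_le_3I[of x y 0])
    show "0 \<le> x $ k \<and> 0 \<le> y $ k \<and> 0 \<le> (0::real^'m) $ k" for k using xy S_nn by simp
    show "\<exists>r s t. 0 \<le> r \<and> 0 \<le> s \<and> 0 \<le> t \<and> column j P = r *\<^sub>R x + s *\<^sub>R y + t *\<^sub>R 0" for j
    proof (cases "\<phi> (column j P) = 0")
      case True
      then show ?thesis using \<phi>_0 by (intro exI[of _ 0]) simp
    next
      case False
      then have "(1 / \<phi> (column j P)) *\<^sub>R column j P \<in> closed_segment x y" using xy(3) by (auto simp: S_def)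
      then obtain r where r: "0 \<le> r" "r \<le> 1" "(1 / \<phi> (column j P)) *\<^sub>R column j P = (1 - r) *\<^sub>R x + r *\<^sub>R y"
        by (auto simp: closed_segment_def)
      have "column j P = \<phi> (column j P) *\<^sub>R ((1 / \<phi> (column j P)) *\<^sub>R column j P)" using False by simp
      also have "\<dots> = (\<phi> (column j P) * (1 - r)) *\<^sub>R x + (\<phi> (column j P) * r) *\<^sub>R y"
        unfolding r(3) by (simp add: scaleR_right_distrib)
      finally have "column j P = (\<phi> (column j P) * (1 - r)) *\<^sub>R x + (\<phi> (column j P) * r) *\<^sub>R y + 0 *\<^sub>R 0" by simp
      moreover have "0 \<le> \<phi> (column j P) * (1 - r)" "0 \<le> \<phi> (column j P) * r" using r \<phi>_nn by simp_all
      ultimately show ?thesis by blast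
    qed
  qed
qed

section \<open>Factorizations and nested cones\<close>

lemma matrix_mult_row_column: "(A ** B) $ i $ j = row i A \<bullet> column j B"
  for A :: "real^'k^'m" and B :: "real^'n^'k"
  by (simp add: matrix_matrix_mult_def row_def column_def inner_vec_def)

lemma nested_imp_nonneg_rank:
  fixes A :: "real^3^'m" and B :: "real^'n^3"
  assumes n: "nested (\<lambda>i. row i A) (\<lambda>j. column j B) m1 m2 m3"
  shows "nonneg_rank_le_3 (A ** B)"
proof (rule nonneg_rank_le_3I[of "A *v m1" "A *v m2" "A *v m3"])
  have mv: "(A *v m) $ k = row k A \<bullet> m" for m k
    by (simp add: matrix_vector_mul_component row_def)
  show "0 \<le> (A *v m1) $ k \<and> 0 \<le> (A *v m2) $ k \<and> 0 \<le> (A *v m3) $ k" for k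
    using n by (simp add: nested_def mv)
  show "\<exists>x y z. 0 \<le> x \<and> 0 \<le> y \<and> 0 \<le> z \<and> column j (A ** B) = x *\<^sub>R (A *v m1) + y *\<^sub>R (A *v m2) + z *\<^sub>R (A *v m3)" for j
  proof -
    obtain x y z where "0 \<le> x" "0 \<le> y" "0 \<le> z" and b: "column j B = x *\<^sub>R m1 + y *\<^sub>R m2 + z *\<^sub>R m3"
      using n unfolding nested_def by blast
    moreover have "column j (A ** B) = A *v column j B"
      by (simp add: vec_eq_iff mv matrix_mult_row_column column_def[of j "A ** B"])
    ultimately show ?thesis
      by (intro exI[of _ x] exI[of _ y] exI[of _ z])
        (simp add: matrix_vector_right_distrib matrix_vector_mult_scaleR)
  qed
qed

lemma full_rank_factors:
  fixes A :: "real^3^'m" and B :: "real^'n^3"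
  assumes "rank (A ** B) = 3"
  shows "rank A = 3" "rank B = 3"
  using assms rank_mul_le_left[of A B] rank_mul_le_right[of A B] rank_bound[of A] rank_bound[of B] by auto

lemma spans_row: "spans (\<lambda>i. row i A)" if "rank A = 3" for A :: "real^3^'m"
proof -
  have "x = 0" if 0: "\<forall>i. row i A \<bullet> x = 0" for x
  proof -
    have "A *v x = 0" using 0 by (simp add: vec_eq_iff matrix_vector_mul_component row_def)
    then show ?thesis using \<open>rank A = 3\<close> matrix_nonfull_linear_equations_eq[of A] by auto
  qed
  then show ?thesis by (simp add: spans_def)
qed

lemma spans_column: "spans (\<lambda>j. column j B)" if "rank B = 3" for B :: "real^'n^3"
  using spans_row[of "transpose B"] that by (simp add: rank_transpose)

text \<open>Two factorizations of a rank 3 matrix through dimension 3 differ by an invertible matrix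
  \<open>N\<close>; the columns of its inverse \<open>M\<close> generate the nested cone.\<close>

lemma nonneg_rank_imp_nested:
  fixes A :: "real^3^'m" and B :: "real^'n^3"
  assumes nr: "nonneg_rank_le_3 (A ** B)" and rk: "rank (A ** B) = 3"
  shows "\<exists>m1 m2 m3. nested (\<lambda>i. row i A) (\<lambda>j. column j B) m1 m2 m3"
proof -
  obtain A' :: "real^3^'m" and B' :: "real^'n^3"
    where nn: "nonneg_matrix A'" "nonneg_matrix B'" and eq: "A ** B = A' ** B'"
    using nr unfolding nonneg_rank_le_3_def by blast
  have full: "rank A = 3" "rank B = 3" "rank A' = 3" "rank B' = 3"
    using full_rank_factors[OF rk] full_rank_factors[of A' B'] rk eq by auto
  obtain R where R: "B ** R = mat 1"
    using full(2) full_rank_surjective[of B] matrix_right_invertible_surjective[of B] by auto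
  define N where "N = B' ** R"
  have A: "A = A' ** N" by (metis N_def R eq matrix_mul_assoc matrix_mul_rid)
  have "rank N = 3" using full(1) rank_mul_le_right[of A' N] rank_bound[of N] A by auto
  then obtain M where M: "N ** M = mat 1" "M ** N = mat 1"
    using full_rank_surjective[of N] matrix_right_invertible_surjective[of N] matrix_left_right_inverse by auto
  have AM: "A ** M = A'" by (metis A M(1) matrix_mul_assoc matrix_mul_rid)
  obtain L where L: "L ** A' = mat 1"
    using full(3) full_rank_injective[of A'] matrix_left_invertible_injective[of A'] by auto
  have "B' = L ** (A' ** B')" by (simp add: L matrix_mul_assoc)
  also have "\<dots> = N ** B" unfolding eq[symmetric] by (subst A) (simp add: L matrix_mul_assoc)
  finally have B: "B = M ** B'" using M(2) by (simp add: matrix_mul_assoc)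
  have "column j B = B' $ 1 $ j *\<^sub>R column 1 M + B' $ 2 $ j *\<^sub>R column 2 M + B' $ 3 $ j *\<^sub>R column 3 M" for j
    unfolding B by (simp add: vec_eq_iff column_def matrix_matrix_mult_def sum_3 mult.commute)
  moreover have "row k A \<bullet> column i M = A' $ k $ i" for k i
    unfolding AM[symmetric] by (simp add: matrix_mult_row_column)
  ultimately have "nested (\<lambda>i. row i A) (\<lambda>j. column j B) (column 1 M) (column 2 M) (column 3 M)"
    using nn unfolding nested_def nonneg_matrix_def by (metis inner_commute)
  then show ?thesis by blast
qed

theorem theorem4p1:
  fixes A :: "real^3^'m" and B :: "real^'n^3"
  shows "nonneg_rank_le_3 (A ** B) \<longleftrightarrow>
    nonneg_matrix (A ** B) \<and>
    (rank (A ** B) < 3 \<or>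
     rank (A ** B) = 3 \<and> (condition_I A B \<or> condition_II A B))"
proof -
  let ?a = "\<lambda>i. row i A" and ?b = "\<lambda>j. column j B"
  have "nonneg_matrix (A ** B)" if nr: "nonneg_rank_le_3 (A ** B)"
  proof -
    obtain A' :: "real^3^'m" and B' :: "real^'n^3"
      where "nonneg_matrix A'" "nonneg_matrix B'" "A ** B = A' ** B'"
      using nr unfolding nonneg_rank_le_3_def by blast
    then show ?thesis by (simp add: nonneg_matrix_def matrix_matrix_mult_def sum_nonneg)
  qed
  moreover have "rank (A ** B) \<le> 3"
    using rank_mul_le_left[of A B] rank_bound[of A] by auto
  moreover have "nonneg_rank_le_3 (A ** B) \<longleftrightarrow> condition_I A B \<or> condition_II A B"
    if nn: "nonneg_matrix (A ** B)" and rk: "rank (A ** B) = 3"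
  proof -
    have s: "spans ?a" "spans ?b"
      using full_rank_factors[OF rk] spans_row spans_column by blast+
    have ab: "0 \<le> ?a k \<bullet> ?b j" "0 \<le> ?b j \<bullet> ?a k" for k j
      using nn by (simp_all add: nonneg_matrix_def matrix_mult_row_column inner_commute)
    show ?thesis unfolding condition_I_eq condition_II_eq
    proof
      assume "nonneg_rank_le_3 (A ** B)"
      then show "vertex_condition ?a ?b \<or> vertex_condition ?b ?a"
        using nonneg_rank_imp_nested[OF _ rk] nested_imp_vertex_condition[OF _ s] by blast
    next
      assume "vertex_condition ?a ?b \<or> vertex_condition ?b ?a"
      then obtain m1 m2 m3 where "nested ?a ?b m1 m2 m3 \<or> nested ?b ?a m1 m2 m3"
        using vertex_condition_imp_nested[of ?a ?b, OF _ s ab(1)]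
          vertex_condition_imp_nested[of ?b ?a, OF _ s(2,1) ab(2)] by blast
      \<comment> \<open>A cone nested for the exchanged pair is first replaced by its dual.\<close>
      then show "nonneg_rank_le_3 (A ** B)"
        using nested_imp_nonneg_rank nested_dual nested_det3_nonzero[OF _ s(1)] by blast
    qed
  qed
  ultimately show ?thesis using nonneg_rank_of_rank_less_3[of "A ** B"] by (meson le_neq_implies_less)
qed

end
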